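(* Let $k\ge 3$, $0\le\alpha<1$, let $G$ be a connected $k$-uniform hypergraph, and let $u,v$ be two pendant vertices in a pendant edge $e$ of $G$. If $p\ge q\ge 1$, then $$\rho_\alpha(G_{u,v}(p,q))>\rho_\alpha(G_{u,v}(p+1,q-1)).$$
   Context: A $k$-uniform hypergraph $G=(V(G),E(G))$ has a finite vertex set and an edge set that is a collection of $k$-subsets of $V(G)$ (no repeated edges). The degree $\deg_G(v)$ is the number of edges containing $v$; $v$ is pendant if $\deg_G(v)=1$. An edge is a pendant edge if all its vertices, except at most one, have degree one. Spectral notation: with $V(G)=\{1,\dots,n\}$, the tensor $\mathcal A_\alpha(G)=\alpha\mathcal D(G)+(1-\alpha)\mathcal A(G)$, where $\mathcal D(G)$ is the diagonal tensor of order $k$ and dimension $n$ with the vertex degrees on the diagonal and $\mathcal A(G)$ is the adjacency tensor of order $k$ and dimension $n$ with entries $a_{i_1\dots i_k}=\frac1{(k-1)!}$ if $\{i_1,\dots,i_k\}\in E(G)$ and $0$ otherwise. Equivalently $(\mathcal A_\alpha(G)\boldsymbol x)_v=\alpha \deg_G(v)x_v^{k-1}+(1-\alpha)\sum_{e\ni v}\prod_{w\in e\setminus\{v\}}x_w$. An eigenvalue is $\lambda\in\mathbb C$ for which there is a nonzero $\boldsymbol x\in\mathbb C^n$ with $\mathcal A_\alpha(G)\boldsymbol x=\lambda \boldsymbol x^{[k-1]}$, where $\boldsymbol x^{[k-1]}=(x_i^{k-1})_i$. The $\alpha$-spectral radius $\rho_\alpha(G)$ is the largest modulus of an eigenvalue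 of $\mathcal A_\alpha(G)$. A loose path of length $d$ is a $k$-uniform hypergraph consisting of distinct edges $e_1,\dots,e_d$ with $|e_i\cap e_j|=1$ if $|i-j|=1$ and $e_i\cap e_j=\varnothing$ if $|i-j|\ge 2$; it is written $v_0e_1v_1\dots e_dv_d$, where $e_i\cap e_{i+1}=\{v_i\}$ for $1\le i\le d-1$, $v_0\in e_1\setminus\{v_1\}$, $v_d\in e_d\setminus\{v_{d-1}\}$ (and $v_0\neq v_1$ if $d=1$); $v_0,v_d$ are its end vertices. A loose path of length $0$ is a single vertex. $G_{u,v}(p,q)$ is the hypergraph obtained from $G$ by attaching a new loose path of length $p$ at $u$ (identifying one end vertex of the path with $u$) and a new loose path of length $q$ at $v$ (identifying one end vertex with $v$), all other vertices of the two paths being new and distinct.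
   Formalization: The formal theorem additionally assumes that G has an edge other than e; if G is the single edge e, both hypergraphs are loose paths of length p+q+1, so their α-spectral radii are equal and the strict inequality fails. *)

theory Defs
  imports Complex_Main "HOL-Library.Infinite_Set" "HOL-Library.Nat_Bijection"
begin

section \<open>Uniform hypergraphs\<close>

record 'a hypergraph =
  verts :: "'a set"
  edges :: "'a set set"

definition uniform_hypergraph :: "nat \<Rightarrow> 'a hypergraph \<Rightarrow> bool" where
  "uniform_hypergraph k G \<longleftrightarrow>
     finite (verts G) \<and> (\<forall>e\<in>edges G. e \<subseteq> verts G \<and> card e = k)"

definition vertex_degree :: "'a hypergraph \<Rightarrow> 'a \<Rightarrow> nat" where
  "vertex_degree G v = card {e \<in> edges G. v \<in> e}"

definition connected_hypergraph :: "'a hypergraph \<Rightarrow> bool" where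
  "connected_hypergraph G \<longleftrightarrow> verts G \<noteq> {} \<and>
     (\<forall>x\<in>verts G. \<forall>y\<in>verts G. (x, y) \<in> {(a, b). \<exists>e\<in>edges G. a \<in> e \<and> b \<in> e}\<^sup>*)"

definition pendant_vertex :: "'a hypergraph \<Rightarrow> 'a \<Rightarrow> bool" where
  "pendant_vertex G v \<longleftrightarrow> v \<in> verts G \<and> vertex_degree G v = 1"

text \<open>As only ``at most one'' vertex is exempted, the edge of a one-edge hypergraph is pendant.
  For such \<open>G\<close> both \<open>G\<^sub>u\<^sub>,\<^sub>v(p, q)\<close> and \<open>G\<^sub>u\<^sub>,\<^sub>v(p + 1, q - 1)\<close> below are loose paths of length
  \<open>p + q + 1\<close>, hence isomorphic, so a strict comparison of their spectral radii has to
  exclude that case.\<close>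

definition pendant_edge :: "'a hypergraph \<Rightarrow> 'a set \<Rightarrow> bool" where
  "pendant_edge G e \<longleftrightarrow> e \<in> edges G \<and> (\<exists>w\<in>e. \<forall>x\<in>e - {w}. vertex_degree G x = 1)"


section \<open>Tensors and the \<open>\<alpha>\<close>-spectral radius\<close>

text \<open>A tensor of order \<open>k\<close> and dimension \<open>card V\<close> is given by its entries: a function on
  index lists of length \<open>k\<close> over the finite set \<open>V\<close>; its values on all other lists are
  irrelevant. Vectors indexed by \<open>V\<close> are functions whose values outside \<open>V\<close> are
  irrelevant. The vertex set itself plays the role of \<open>{1..n}\<close>.\<close>

definition degree_tensor :: "'a hypergraph \<Rightarrow> 'a list \<Rightarrow> real" where
  "degree_tensor G is =
     (if \<forall>i\<in>set is. i = hd is then real (vertex_degree G (hd is)) else 0)"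

definition adjacency_tensor :: "nat \<Rightarrow> 'a hypergraph \<Rightarrow> 'a list \<Rightarrow> real" where
  "adjacency_tensor k G is = (if set is \<in> edges G then 1 / fact (k - 1) else 0)"

definition alpha_tensor :: "nat \<Rightarrow> real \<Rightarrow> 'a hypergraph \<Rightarrow> 'a list \<Rightarrow> real" where
  "alpha_tensor k \<alpha> G is = \<alpha> * degree_tensor G is + (1 - \<alpha>) * adjacency_tensor k G is"

definition tensor_apply ::
    "nat \<Rightarrow> 'a set \<Rightarrow> ('a list \<Rightarrow> real) \<Rightarrow> ('a \<Rightarrow> complex) \<Rightarrow> 'a \<Rightarrow> complex" where
  "tensor_apply k V T x v =
     (\<Sum>is | set is \<subseteq> V \<and> length is = k - 1. complex_of_real (T (v # is)) * prod_list (map x is))"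

definition tensor_eigenvalue :: "nat \<Rightarrow> 'a set \<Rightarrow> ('a list \<Rightarrow> real) \<Rightarrow> complex \<Rightarrow> bool" where
  "tensor_eigenvalue k V T \<mu> \<longleftrightarrow>
     (\<exists>x. (\<exists>v\<in>V. x v \<noteq> 0) \<and> (\<forall>v\<in>V. tensor_apply k V T x v = \<mu> * x v ^ (k - 1)))"

definition alpha_spectral_radius :: "nat \<Rightarrow> real \<Rightarrow> 'a hypergraph \<Rightarrow> real" where
  "alpha_spectral_radius k \<alpha> G =
     (GREATEST r. \<exists>\<mu>. tensor_eigenvalue k (verts G) (alpha_tensor k \<alpha> G) \<mu> \<and> r = cmod \<mu>)"

lemma card_lists_enumerating:
  assumes "finite A"
  shows "card {xs. set xs = A \<and> length xs = card A} = fact (card A)"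
proof -
  have "set xs = A \<and> length xs = card A \<longleftrightarrow>
      length xs = card A \<and> distinct xs \<and> set xs \<subseteq> A" for xs
    using card_distinct[of xs] distinct_card[of xs] card_subset_eq[OF assms, of "set xs"]
    by auto
  then have "{xs. set xs = A \<and> length xs = card A} =
      {xs. length xs = card A \<and> distinct xs \<and> set xs \<subseteq> A}"
    by simp
  then show ?thesis
    using card_lists_distinct_length_eq[OF assms, of "card A"] by (simp add: fact_prod)
qed

lemma degree_tensor_apply:
  assumes fin: "finite (verts G)" and v: "v \<in> verts G"
  shows "(\<Sum>is | set is \<subseteq> verts G \<and> length is = k - 1.
            complex_of_real (degree_tensor G (v # is)) * prod_list (map x is))
       = of_nat (vertex_degree G v) * x v ^ (k - 1)"
proof -
  let ?L = "{is. set is \<subseteq> verts G \<and> length is = k - 1}"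
  let ?f = "\<lambda>is. complex_of_real (degree_tensor G (v # is)) * prod_list (map x is)"
  have "sum ?f ?L = sum ?f {replicate (k - 1) v}"
  proof (rule sum.mono_neutral_right)
    show "finite ?L" using fin by (rule finite_lists_length_eq)
    show "{replicate (k - 1) v} \<subseteq> ?L" using v by auto
    show "\<forall>is\<in>?L - {replicate (k - 1) v}. ?f is = 0"
      by (auto simp: degree_tensor_def intro: replicate_eqI)
  qed
  also have "\<dots> = of_nat (vertex_degree G v) * x v ^ (k - 1)"
    by (simp add: degree_tensor_def prod_list_replicate)
  finally show ?thesis .
qed

lemma adjacency_tensor_apply:
  assumes G: "uniform_hypergraph k G" and k: "k \<ge> 1"
  shows "(\<Sum>is | set is \<subseteq> verts G \<and> length is = k - 1.
            complex_of_real (adjacency_tensor k G (v # is)) * prod_list (map x is))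
       = (\<Sum>e | e \<in> edges G \<and> v \<in> e. \<Prod>w\<in>e - {v}. x w)"
proof -
  let ?L = "{xs. set xs \<subseteq> verts G \<and> length xs = k - 1}"
  let ?c = "complex_of_real (1 / fact (k - 1))"
  let ?f = "\<lambda>xs. complex_of_real (adjacency_tensor k G (v # xs)) * prod_list (map x xs)"
  let ?E = "{e. e \<in> edges G \<and> v \<in> e}"
  let ?S = "\<lambda>e. {xs. set xs = e - {v} \<and> length xs = card (e - {v})}"
  have finV: "finite (verts G)" and E: "\<And>e. e \<in> edges G \<Longrightarrow> e \<subseteq> verts G \<and> card e = k"
    using G by (auto simp: uniform_hypergraph_def)
  have finE: "finite ?E"
    by (rule finite_subset[of _ "Pow (verts G)"]) (use E finV in auto)
  have card_e: "card (e - {v}) = k - 1" if "e \<in> ?E" for e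
    using that E[of e] by simp
  have finS: "finite (?S e)" if "e \<in> ?E" for e
  proof (rule finite_subset)
    have "e - {v} \<subseteq> verts G" using that E by blast
    then show "finite {xs. set xs \<subseteq> e - {v} \<and> length xs = k - 1}"
      using finV finite_subset by (intro finite_lists_length_eq) blast
    show "?S e \<subseteq> {xs. set xs \<subseteq> e - {v} \<and> length xs = k - 1}"
      using card_e[OF that] by auto
  qed
  have "sum ?f ?L = sum ?f (\<Union>e\<in>?E. ?S e)"
  proof (rule sum.mono_neutral_right)
    show "finite ?L" using finV by (rule finite_lists_length_eq)
    show "(\<Union>e\<in>?E. ?S e) \<subseteq> ?L"
    proof (rule UN_least)
      fix e assume e: "e \<in> ?E"
      then have "e - {v} \<subseteq> verts G" using E by blast
      then show "?S e \<subseteq> ?L" using card_e[OF e] by auto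
    qed
    show "\<forall>xs\<in>?L - (\<Union>e\<in>?E. ?S e). ?f xs = 0"
    proof
      fix xs assume xs: "xs \<in> ?L - (\<Union>e\<in>?E. ?S e)"
      have "insert v (set xs) \<notin> edges G"
      proof
        assume *: "insert v (set xs) \<in> edges G"
        then have ins: "insert v (set xs) \<in> ?E" by simp
        have "v \<notin> set xs"
        proof
          assume "v \<in> set xs"
          then have "k = card (set xs)" using E[OF *] by (simp add: insert_absorb)
          with xs k card_length[of xs] show False by simp
        qed
        then have "set xs = insert v (set xs) - {v}" by simp
        moreover have "length xs = card (insert v (set xs) - {v})"
          using xs card_e[OF ins] by simp
        ultimately have "xs \<in> ?S (insert v (set xs))" by simp
        with xs ins show False by blast
      qed
      then show "?f xs = 0" by (simp add: adjacency_tensor_def)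
    qed
  qed
  also have "\<dots> = (\<Sum>e\<in>?E. sum ?f (?S e))"
  proof (rule sum.UNION_disjoint)
    show "\<forall>e\<in>?E. \<forall>e'\<in>?E. e \<noteq> e' \<longrightarrow> ?S e \<inter> ?S e' = {}"
    proof (intro ballI impI)
      fix e e' assume "e \<in> ?E" "e' \<in> ?E" "e \<noteq> e'"
      then have "e - {v} \<noteq> e' - {v}" by blast
      then show "?S e \<inter> ?S e' = {}" by blast
    qed
  qed (use finE finS in blast)+
  also have "\<dots> = (\<Sum>e\<in>?E. \<Prod>w\<in>e - {v}. x w)"
  proof (rule sum.cong[OF refl])
    fix e assume e: "e \<in> ?E"
    have "?f xs = ?c * (\<Prod>w\<in>e - {v}. x w)" if "xs \<in> ?S e" for xs
    proof -
      have sx: "set xs = e - {v}" and "length xs = card (e - {v})" using that by blast+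
      then have "distinct xs" by (intro card_distinct) simp
      then have "prod_list (map x xs) = (\<Prod>w\<in>e - {v}. x w)"
        using prod.distinct_set_conv_list[of xs x] unfolding sx by simp
      moreover have "insert v (set xs) = e" using sx e by blast
      ultimately show ?thesis using e by (simp add: adjacency_tensor_def)
    qed
    then have "sum ?f (?S e) = (\<Sum>xs\<in>?S e. ?c * (\<Prod>w\<in>e - {v}. x w))"
      by (rule sum.cong[OF refl])
    also have "\<dots> = of_nat (fact (k - 1)) * (?c * (\<Prod>w\<in>e - {v}. x w))"
      using card_lists_enumerating[of "e - {v}"] card_e[OF e] finite_subset[OF _ finV, of e] e E
      by simp
    finally show "sum ?f (?S e) = (\<Prod>w\<in>e - {v}. x w)" by simp
  qed
  finally show ?thesis .
qed

lemma alpha_tensor_apply: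
  assumes "uniform_hypergraph k G" and "k \<ge> 1" and "v \<in> verts G"
  shows "tensor_apply k (verts G) (alpha_tensor k \<alpha> G) x v =
     of_real \<alpha> * of_nat (vertex_degree G v) * x v ^ (k - 1)
     + of_real (1 - \<alpha>) * (\<Sum>e | e \<in> edges G \<and> v \<in> e. \<Prod>w\<in>e - {v}. x w)"
proof -
  have fin: "finite (verts G)" using assms(1) by (simp add: uniform_hypergraph_def)
  show ?thesis
    unfolding adjacency_tensor_apply[OF assms(1,2), symmetric] mult.assoc
      degree_tensor_apply[OF fin assms(3), symmetric] tensor_apply_def alpha_tensor_def
    by (simp only: sum_distrib_left sum.distrib[symmetric] of_real_add of_real_mult
        distrib_right mult.assoc)
qed


section \<open>Loose paths and their attachment\<close>

text \<open>\<open>loose_path k P vs es\<close>: the hypergraph \<open>P\<close> is the \<open>k\<close>-uniform loose path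
  \<open>v\<^sub>0 e\<^sub>1 v\<^sub>1 \<dots> e\<^sub>d v\<^sub>d\<close> with \<open>vs = [v\<^sub>0, \<dots>, v\<^sub>d]\<close> and \<open>es = [e\<^sub>1, \<dots>, e\<^sub>d]\<close>.
  Lists are indexed from 0, so \<open>e\<^sub>i\<close> is \<open>es ! (i - 1)\<close> while \<open>v\<^sub>i\<close> is \<open>vs ! i\<close>.\<close>

definition loose_path :: "nat \<Rightarrow> 'a hypergraph \<Rightarrow> 'a list \<Rightarrow> 'a set list \<Rightarrow> bool" where
  "loose_path k P vs es \<longleftrightarrow>
     length vs = length es + 1 \<and>
     verts P = insert (hd vs) (\<Union>(set es)) \<and> edges P = set es \<and>
     distinct es \<and> (\<forall>e\<in>set es. card e = k) \<and>
     (\<forall>i. i + 1 < length es \<longrightarrow> es ! i \<inter> es ! (i + 1) = {vs ! (i + 1)}) \<and>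
     (\<forall>i j. i + 2 \<le> j \<and> j < length es \<longrightarrow> es ! i \<inter> es ! j = {}) \<and>
     (es \<noteq> [] \<longrightarrow>
        vs ! 0 \<in> hd es - {vs ! 1} \<and>
        vs ! length es \<in> last es - {vs ! (length es - 1)})"

text \<open>\<open>G\<^sub>u\<^sub>,\<^sub>v(p, q)\<close> is only determined up to the names of the new vertices;
  \<open>attached_paths k G u v p q H\<close> says that \<open>H\<close> is such a hypergraph.\<close>

definition attached_paths ::
    "nat \<Rightarrow> 'a hypergraph \<Rightarrow> 'a \<Rightarrow> 'a \<Rightarrow> nat \<Rightarrow> nat \<Rightarrow> 'a hypergraph \<Rightarrow> bool" where
  "attached_paths k G u v p q H \<longleftrightarrow>
     (\<exists>P Q vs es ws fs.
        loose_path k P vs es \<and> length es = p \<and> hd vs = u \<and>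
        loose_path k Q ws fs \<and> length fs = q \<and> hd ws = v \<and>
        verts P \<inter> verts G = {u} \<and> verts Q \<inter> verts G = {v} \<and> verts P \<inter> verts Q = {} \<and>
        H = \<lparr>verts = verts G \<union> verts P \<union> verts Q, edges = edges G \<union> edges P \<union> edges Q\<rparr>)"

text \<open>Such an \<open>H\<close> exists whenever the type offers infinitely many vertex names.\<close>

lemma loose_path_exists:
  assumes k: "k \<ge> 2" and fin: "finite F" and inf: "infinite (UNIV :: 'a set)"
  shows "\<exists>(P :: 'a hypergraph) vs es.
    loose_path k P vs es \<and> length es = d \<and> hd vs = u \<and> verts P \<inter> F \<subseteq> {u} \<and> finite (verts P)"
proof -
  have "infinite (- insert u F)"
    using fin inf by (metis finite_insert finite_compl)
  then obtain h :: "nat \<Rightarrow> 'a" where h: "inj h" "range h \<subseteq> - insert u F"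
    by (meson infinite_countable_subset)
  define g where "g i j = h (prod_encode (i, j))" for i j
  have g_eq [simp]: "g i j = g i' j' \<longleftrightarrow> i = i' \<and> j = j'" for i j i' j'
    using h(1) by (simp add: g_def inj_eq prod_encode_eq)
  have g_new: "g i j \<noteq> u" "g i j \<notin> F" "u \<noteq> g i j" for i j
    using h(2) unfolding g_def by blast+
  define w where "w i = (case i of 0 \<Rightarrow> u | Suc m \<Rightarrow> g m 0)" for i
  define N where "N i = g i ` {..<k - 1}" for i
  define ed where "ed i = insert (w i) (N i)" for i
  have w_simps [simp]: "w 0 = u" "w (Suc m) = g m 0" for m by (auto simp: w_def)
  have N_iff: "g i j \<in> N m \<longleftrightarrow> i = m \<and> j < k - 1" "u \<notin> N m" for i j m
    using g_new by (auto simp: N_def)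
  have w_N: "w i \<in> N m \<longleftrightarrow> i = Suc m" for i m
    using k by (cases i) (auto simp: N_iff)
  have w_eq: "w i = w j \<longleftrightarrow> i = j" for i j
    using g_new by (cases i; cases j) auto
  have N_disj: "N i \<inter> N j = {}" if "i \<noteq> j" for i j
    using that by (auto simp: N_def)
  have card_N: "card (N i) = k - 1" for i
    unfolding N_def by (subst card_image) (auto simp: inj_on_def)
  have fin_N: "finite (N i)" for i by (simp add: N_def)
  have card_ed: "card (ed i) = k" for i
    using k by (simp add: ed_def fin_N w_N card_N)
  have adj: "ed i \<inter> ed (Suc i) = {w (Suc i)}" for i
    using N_disj[of i "Suc i"] w_N[of "Suc i" i] w_N[of i "Suc i"] w_eq[of i "Suc i"]
    unfolding ed_def by auto
  have far: "ed i \<inter> ed j = {}" if "i + 2 \<le> j" for i j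
    using that N_disj[of i j] w_N[of i j] w_N[of j i] w_eq[of i j]
    unfolding ed_def by auto
  have inj_ed: "inj_on ed S" for S
  proof (rule inj_onI)
    fix i j assume "ed i = ed j"
    show "i = j"
    proof (rule ccontr)
      assume "i \<noteq> j"
      then have "N i \<inter> ed j \<subseteq> {w j}" using N_disj[of i j] by (auto simp: ed_def)
      moreover have "N j \<inter> ed i \<subseteq> {w i}" using N_disj[of i j] \<open>i \<noteq> j\<close> by (auto simp: ed_def)
      moreover have "w (Suc i) \<in> N i" "w (Suc j) \<in> N j" by (simp_all add: w_N del: w_simps)
      ultimately have "w (Suc i) = w j" "w (Suc j) = w i"
        using \<open>ed i = ed j\<close> unfolding ed_def by auto
      then show False unfolding w_eq by simp
    qed
  qed
  let ?es = "map ed [0..<d]" and ?vs = "map w [0..<Suc d]"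
  let ?P = "\<lparr>verts = insert u (\<Union>(set ?es)), edges = set ?es\<rparr>"
  have hd_vs: "hd ?vs = u" by (simp add: hd_map del: upt_Suc)
  have "loose_path k ?P ?vs ?es"
    unfolding loose_path_def
  proof (intro conjI)
    show "distinct ?es" using inj_ed by (simp add: distinct_map)
    show "verts ?P = insert (hd ?vs) (\<Union>(set ?es))" by (simp add: hd_vs del: upt_Suc)
    show "\<forall>i. i + 1 < length ?es \<longrightarrow> ?es ! i \<inter> ?es ! (i + 1) = {?vs ! (i + 1)}"
      using adj by (simp del: upt_Suc w_simps)
    show "\<forall>i j. i + 2 \<le> j \<and> j < length ?es \<longrightarrow> ?es ! i \<inter> ?es ! j = {}"
      using far by simp
    show "?es \<noteq> [] \<longrightarrow>
        ?vs ! 0 \<in> hd ?es - {?vs ! 1} \<and>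
        ?vs ! length ?es \<in> last ?es - {?vs ! (length ?es - 1)}"
    proof (cases d)
      case (Suc m)
      then show ?thesis
        using w_eq[of 0 1] w_N[of "Suc m" m] w_eq[of "Suc m" m]
        by (simp add: hd_map last_map ed_def nth_append g_new del: upt_Suc)
    qed simp
  qed (simp_all add: card_ed)
  moreover have "w i \<notin> F - {u}" for i using g_new by (cases i) auto
  then have "verts ?P \<inter> F \<subseteq> {u}"
    using g_new(2) by (fastforce simp: ed_def N_def)
  moreover have "finite (verts ?P)" by (simp add: ed_def fin_N)
  ultimately show ?thesis using hd_vs by (metis length_map length_upt diff_zero)
qed

lemma attached_paths_exists:
  fixes G :: "'a hypergraph"
  assumes "k \<ge> 2" and "uniform_hypergraph k G" and "infinite (UNIV :: 'a set)"
    and "u \<in> verts G" and "v \<in> verts G" and "u \<noteq> v"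
  shows "\<exists>H. attached_paths k G u v p q H"
proof -
  have fin: "finite (verts G)" using assms(2) by (simp add: uniform_hypergraph_def)
  obtain P :: "'a hypergraph" and vs es where P: "loose_path k P vs es" "length es = p" "hd vs = u"
      "verts P \<inter> verts G \<subseteq> {u}" "finite (verts P)"
    using loose_path_exists[OF assms(1) fin assms(3)] by metis
  obtain Q :: "'a hypergraph" and ws fs where Q: "loose_path k Q ws fs" "length fs = q" "hd ws = v"
      "verts Q \<inter> (verts G \<union> verts P) \<subseteq> {v}"
    using loose_path_exists[OF assms(1) _ assms(3), of "verts G \<union> verts P"] fin P(5)
    by (metis finite_UnI)
  have "u \<in> verts P" "v \<in> verts Q" using P(1,3) Q(1,3) by (auto simp: loose_path_def)
  then have "verts P \<inter> verts G = {u}" "verts Q \<inter> verts G = {v}" "verts P \<inter> verts Q = {}"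
    using P(4) Q(4) assms(4-6) by auto
  with P(1-3) Q(1-3) show ?thesis unfolding attached_paths_def by blast
qed

end

theory Submission
  imports Defs "HOL-Analysis.Function_Topology"
begin

text \<open>The spectral radius of a connected hypergraph is the maximum over nonnegative vectors of the
  Rayleigh quotient of the tensor, and it is attained at a positive eigenvector. For such an
  eigenvector \<open>x\<close> with eigenvalue \<open>\<rho>\<close>, a pendant path of length \<open>d\<close> acts on the equation at its root
  only through a number \<open>b\<^sub>d\<close>, where \<open>b\<^sub>0 = \<rho> - \<alpha>\<close> and \<open>b\<^sub>d\<^sub>+\<^sub>1 = \<rho> - 2\<alpha> - M / b\<^sub>d\<close> with
  \<open>M = (1 - \<alpha>)\<^sup>k / (\<rho> - \<alpha>)\<^sup>k\<^sup>-\<^sup>2\<close>. Take the Perron vector of \<open>G\<^sub>u\<^sub>,\<^sub>v(p + 1, q - 1)\<close>. Multiplying the equations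
  at the vertices of \<open>e\<close>, of which the one joining \<open>e\<close> to the rest of \<open>G\<close> is strict, gives
  \<open>b\<^sub>p\<^sub>+\<^sub>1 b\<^sub>q\<^sub>-\<^sub>1 > M\<close>; as \<open>b\<^sub>p < b\<^sub>q\<^sub>-\<^sub>1\<close>, this is equivalent to \<open>b\<^sub>p b\<^sub>q < b\<^sub>p\<^sub>+\<^sub>1 b\<^sub>q\<^sub>-\<^sub>1\<close>. Rescaling the entries at \<open>u\<close> and \<open>v\<close> by the
  \<open>k\<close>-th roots of \<open>b\<^sub>p\<^sub>+\<^sub>1 / b\<^sub>p\<close> and \<open>b\<^sub>q\<^sub>-\<^sub>1 / b\<^sub>q\<close> therefore enlarges the product over \<open>e\<close>, and
  continuing along the two paths of \<open>G\<^sub>u\<^sub>,\<^sub>v(p, q)\<close> yields a vector with Rayleigh quotient greater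
  than \<open>\<rho>\<close>.\<close>

section \<open>The variational characterization of the spectral radius\<close>

text \<open>\<open>vertex_form k \<alpha> (edges K) x v\<close> is \<open>x\<^sub>v (\<A>\<^sub>\<alpha>(K) x)\<^sub>v\<close>; unlike \<open>(\<A>\<^sub>\<alpha>(K) x)\<^sub>v\<close> it involves the
  products over whole edges, and it is additive in the edge set.\<close>

definition vertex_form :: "nat \<Rightarrow> real \<Rightarrow> 'a set set \<Rightarrow> ('a \<Rightarrow> real) \<Rightarrow> 'a \<Rightarrow> real" where
  "vertex_form k \<alpha> E x v = (\<Sum>e | e \<in> E \<and> v \<in> e. \<alpha> * x v ^ k + (1 - \<alpha>) * prod x e)"

section \<open>Identities for the vertex form of a uniform hypergraph\<close>

lemma uniform_hypergraphD:
  assumes "uniform_hypergraph k K" and "k \<ge> 1"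
  shows "finite (verts K)" and "finite (edges K)"
    and "e \<in> edges K \<Longrightarrow> e \<subseteq> verts K" and "e \<in> edges K \<Longrightarrow> finite e"
    and "e \<in> edges K \<Longrightarrow> card e = k"
proof -
  show fin: "finite (verts K)" and "e \<in> edges K \<Longrightarrow> e \<subseteq> verts K"
    and card: "e \<in> edges K \<Longrightarrow> card e = k" for e
    using assms(1) by (auto simp: uniform_hypergraph_def)
  show "finite (edges K)"
    by (rule finite_subset[of _ "Pow (verts K)"])
      (use assms(1) in \<open>auto simp: uniform_hypergraph_def\<close>)
  show "e \<in> edges K \<Longrightarrow> finite e"
    using card[of e] assms(2) by (metis card.infinite not_one_le_zero)
qed

lemma vertex_form_factor:
  assumes "uniform_hypergraph k K" and "k \<ge> 1"
  shows "vertex_form k \<alpha> (edges K) x v =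
    x v * (\<alpha> * vertex_degree K v * x v ^ (k - 1)
      + (1 - \<alpha>) * (\<Sum>e | e \<in> edges K \<and> v \<in> e. prod x (e - {v})))"
proof -
  have "prod x e = x v * prod x (e - {v})" if "e \<in> edges K" "v \<in> e" for e
    using prod.remove[of e v x] uniform_hypergraphD(4)[OF assms that(1)] that(2) by simp
  then have "vertex_form k \<alpha> (edges K) x v =
      (\<Sum>e | e \<in> edges K \<and> v \<in> e. \<alpha> * x v ^ k + (1 - \<alpha>) * (x v * prod x (e - {v})))"
    unfolding vertex_form_def by (intro sum.cong) auto
  also have "\<dots> = vertex_degree K v * (\<alpha> * x v ^ k)
      + (\<Sum>e | e \<in> edges K \<and> v \<in> e. (1 - \<alpha>) * (x v * prod x (e - {v})))"
    by (simp add: sum.distrib vertex_degree_def)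
  also have "(\<Sum>e | e \<in> edges K \<and> v \<in> e. (1 - \<alpha>) * (x v * prod x (e - {v})))
      = (1 - \<alpha>) * x v * (\<Sum>e | e \<in> edges K \<and> v \<in> e. prod x (e - {v}))"
    by (simp add: sum_distrib_left mult.assoc)
  also have "x v ^ k = x v * x v ^ (k - 1)"
    using assms(2) by (cases k) auto
  finally show ?thesis by (simp add: algebra_simps)
qed

text \<open>Double counting of incidences. Written edge by edge, the numerator of the Rayleigh
  quotient is visibly monotone in nonnegative entries, and the terms affected by changing a few
  entries can be isolated.\<close>

lemma sum_vertex_form:
  assumes "uniform_hypergraph k K" and "k \<ge> 1"
  shows "(\<Sum>v\<in>verts K. vertex_form k \<alpha> (edges K) x v) =
    (\<Sum>e\<in>edges K. \<alpha> * (\<Sum>v\<in>e. x v ^ k) + (1 - \<alpha>) * k * prod x e)"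
proof -
  note K = uniform_hypergraphD[OF assms]
  have "(\<Sum>v\<in>verts K. vertex_form k \<alpha> (edges K) x v) =
      (\<Sum>v\<in>verts K. \<Sum>e\<in>edges K. if v \<in> e then \<alpha> * x v ^ k + (1 - \<alpha>) * prod x e else 0)"
    unfolding vertex_form_def using K(2) by (intro sum.cong refl sum.inter_filter)
  also have "\<dots> =
      (\<Sum>e\<in>edges K. \<Sum>v\<in>verts K. if v \<in> e then \<alpha> * x v ^ k + (1 - \<alpha>) * prod x e else 0)"
    by (rule sum.swap)
  also have "\<dots> = (\<Sum>e\<in>edges K. \<Sum>v\<in>e. \<alpha> * x v ^ k + (1 - \<alpha>) * prod x e)"
  proof (rule sum.cong[OF refl])
    fix e assume "e \<in> edges K"
    then have "{v \<in> verts K. v \<in> e} = e" using K(3) by blast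
    then show "(\<Sum>v\<in>verts K. if v \<in> e then \<alpha> * x v ^ k + (1 - \<alpha>) * prod x e else 0)
        = (\<Sum>v\<in>e. \<alpha> * x v ^ k + (1 - \<alpha>) * prod x e)"
      by (simp flip: sum.inter_filter[OF K(1)])
  qed
  also have "\<dots> = (\<Sum>e\<in>edges K. \<alpha> * (\<Sum>v\<in>e. x v ^ k) + (1 - \<alpha>) * k * prod x e)"
    by (intro sum.cong refl) (simp add: sum.distrib sum_distrib_left K(5))
  finally show ?thesis .
qed

lemma vertex_form_scale:
  assumes "uniform_hypergraph k K" and "k \<ge> 1"
  shows "vertex_form k \<alpha> (edges K) (\<lambda>w. c * x w) v = c ^ k * vertex_form k \<alpha> (edges K) x v"
  unfolding vertex_form_def sum_distrib_left
  using uniform_hypergraphD(5)[OF assms]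
  by (intro sum.cong) (auto simp: prod.distrib power_mult_distrib algebra_simps)

text \<open>Compactness yields a maximum on the nonnegative part of the unit sphere of the
  \<open>k\<close>-norm. Both sides of the last bound are homogeneous of degree \<open>k\<close>, so
  normalizing \<open>y\<close> extends the bound to all nonnegative vectors.\<close>

lemma exists_maximizer:
  assumes U: "uniform_hypergraph k K" and k: "k \<ge> 1" and ne: "verts K \<noteq> {}"
  obtains x \<rho> where "\<And>v. v \<in> verts K \<Longrightarrow> 0 \<le> x v" and "(\<Sum>v\<in>verts K. x v ^ k) = 1"
    and "(\<Sum>v\<in>verts K. vertex_form k \<alpha> (edges K) x v) = \<rho>"
    and "\<And>y. (\<And>v. v \<in> verts K \<Longrightarrow> 0 \<le> y v) \<Longrightarrow>
      (\<Sum>v\<in>verts K. vertex_form k \<alpha> (edges K) y v) \<le> \<rho> * (\<Sum>v\<in>verts K. y v ^ k)"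
proof -
  let ?V = "verts K" and ?N = "\<lambda>y. \<Sum>v\<in>verts K. y v ^ k :: real"
  let ?F = "\<lambda>y. \<Sum>v\<in>verts K. vertex_form k \<alpha> (edges K) y v"
  note K = uniform_hypergraphD[OF U k]
  \<comment> \<open>Vectors are functions on the whole type, which may be infinite. Pinning the
    coordinates outside the vertex set to 0 makes the unit cube a product of compact sets, so
    Tychonoff's theorem applies.\<close>
  define B :: "('a \<Rightarrow> real) set" where
    "B = PiE UNIV (\<lambda>v. if v \<in> ?V then {0..1} else {0})"
  have "compactin (product_topology (\<lambda>_. euclidean) UNIV) B"
    unfolding B_def compactin_PiE by auto
  then have "compact B" by (simp add: euclidean_product_topology)
  have contN: "continuous_on UNIV ?N"
    by (intro continuous_intros continuous_on_product_coordinates)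
  have "closed {y. ?N y = 1}"
    using contN continuous_on_const by (rule closed_Collect_eq)
  with \<open>compact B\<close> have comp: "compact (B \<inter> {y. ?N y = 1})" by (rule compact_Int_closed)
  obtain a where a: "a \<in> ?V" using ne by blast
  have "?N (\<lambda>w. if w = a then 1 else 0) = (\<Sum>v\<in>?V. if v = a then 1 else 0)"
    using k by (intro sum.cong) auto
  then have "?N (\<lambda>w. if w = a then 1 else 0) = 1" using a K(1) by simp
  then have "(\<lambda>w. if w = a then 1 else 0) \<in> B \<inter> {y. ?N y = 1}"
    using a by (auto simp: B_def)
  then have ne: "B \<inter> {y. ?N y = 1} \<noteq> {}" by blast
  have contF: "continuous_on (B \<inter> {y. ?N y = 1}) ?F"
    unfolding vertex_form_def
    by (rule continuous_on_subset[of UNIV])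
      (intro continuous_intros continuous_on_product_coordinates | simp)+
  obtain x where x: "x \<in> B" "?N x = 1" and
    max: "\<And>y. y \<in> B \<Longrightarrow> ?N y = 1 \<Longrightarrow> ?F y \<le> ?F x"
    using continuous_attains_sup[OF comp ne contF] by blast
  show thesis
  proof (rule that[of x "?F x"])
    show "0 \<le> x v" if "v \<in> ?V" for v
    proof -
      have "x v \<in> (if v \<in> ?V then {0..1} else {0})" using x(1) unfolding B_def by blast
      then show ?thesis using that by simp
    qed
    show "?N x = 1" by (fact x(2))
    fix y :: "'a \<Rightarrow> real" assume y: "\<And>v. v \<in> ?V \<Longrightarrow> 0 \<le> y v"
    show "?F y \<le> ?F x * ?N y"
    proof (cases "?N y = 0")
      case True
      then have "\<forall>v\<in>?V. y v ^ k = 0"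
        using K(1) y by (subst (asm) sum_nonneg_eq_0_iff) auto
      then have y0: "\<forall>v\<in>?V. y v = 0" by auto
      then have "vertex_form k \<alpha> (edges K) y v = 0" if "v \<in> ?V" for v
        using that by (simp add: vertex_form_factor[OF U k])
      then show ?thesis using True by simp
    next
      case False
      have N0: "0 \<le> ?N y" using y by (intro sum_nonneg) auto
      with False have Npos: "0 < ?N y" by simp
      define c where "c = inverse (root k (?N y))"
      have c: "c > 0" and ck: "c ^ k * ?N y = 1"
        using Npos k by (auto simp: c_def power_inverse real_root_pow_pos2)
      define z where "z w = (if w \<in> ?V then c * y w else 0)" for w
      have Nz: "?N z = 1"
        using ck by (simp add: z_def power_mult_distrib sum_distrib_left)
      have z01: "z v \<in> {0..1}" if "v \<in> ?V" for v
      proof -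
        have "z v \<ge> 0" using that y c by (simp add: z_def)
        have "z v ^ k \<le> ?N z"
          using K(1) that y c by (intro member_le_sum) (auto simp: z_def)
        then have "z v ^ k \<le> 1 ^ k" using Nz by simp
        then have "z v \<le> 1" using k by (intro power_le_imp_le_base[of "z v" "k - 1" 1]) auto
        with \<open>z v \<ge> 0\<close> show ?thesis by simp
      qed
      have "z \<in> B" using z01 by (auto simp: B_def z_def)
      from max[OF this Nz] have "?F z \<le> ?F x" .
      have zv: "z v = c * y v" if "v \<in> ?V" for v using that by (simp add: z_def)
      have prodz: "prod z e = prod (\<lambda>w. c * y w) e" if "e \<in> edges K" for e
        using K(3)[OF that] by (intro prod.cong) (auto simp: z_def)
      have "?F z = ?F (\<lambda>w. c * y w)"
        unfolding vertex_form_def by (intro sum.cong refl) (simp add: prodz zv)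
      also have "\<dots> = c ^ k * ?F y"
        by (simp add: vertex_form_scale[OF U k] sum_distrib_left)
      finally have "c ^ k * ?F y \<le> ?F x * (c ^ k * ?N y)"
        using \<open>?F z \<le> ?F x\<close> ck by simp
      then have "c ^ k * ?F y \<le> c ^ k * (?F x * ?N y)" by (simp add: mult.left_commute)
      then show ?thesis using c by simp
    qed
  qed simp
qed

text \<open>A walk from a vertex of \<open>Z\<close> to a vertex outside \<open>Z\<close> has a
  first step that leaves \<open>Z\<close>, and the edge of this step contains both kinds of
  vertices.\<close>

lemma connected_hypergraph_crossing_edge:
  assumes "connected_hypergraph K" and "Z \<subseteq> verts K" and "Z \<noteq> {}" and "Z \<noteq> verts K"
  obtains e a b where "e \<in> edges K" and "a \<in> e" and "b \<in> e" and "a \<in> Z" and "b \<notin> Z"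
proof -
  obtain a b where ab: "a \<in> Z" "b \<in> verts K - Z" using assms(2-4) by blast
  have "(a, b) \<in> {(a, b). \<exists>e\<in>edges K. a \<in> e \<and> b \<in> e}\<^sup>*"
    using ab assms(1,2) by (auto simp: connected_hypergraph_def)
  then have "b \<in> Z \<or> (\<exists>e\<in>edges K. \<exists>a b. a \<in> e \<and> b \<in> e \<and> a \<in> Z \<and> b \<notin> Z)"
    by (induction rule: rtrancl_induct) (use ab in auto)
  with ab that show thesis by blast
qed

text \<open>If an edge contained both zero and nonzero entries of a maximizer, raising its \<open>m < k\<close> zero
  entries to \<open>\<epsilon>\<close> would gain a term of order \<open>\<epsilon>\<^sup>m\<close> at a cost of order \<open>\<epsilon>\<^sup>k\<close>.\<close>

lemma maximizer_positive:
  assumes U: "uniform_hypergraph k K" and k: "k \<ge> 1" and conn: "connected_hypergraph K"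
    and \<alpha>: "0 \<le> \<alpha>" "\<alpha> < 1"
    and x0: "\<And>v. v \<in> verts K \<Longrightarrow> 0 \<le> x v" and N1: "(\<Sum>v\<in>verts K. x v ^ k) = 1"
    and Fx: "(\<Sum>v\<in>verts K. vertex_form k \<alpha> (edges K) x v) = \<rho>"
    and max: "\<And>y. (\<And>v. v \<in> verts K \<Longrightarrow> 0 \<le> y v) \<Longrightarrow>
      (\<Sum>v\<in>verts K. vertex_form k \<alpha> (edges K) y v) \<le> \<rho> * (\<Sum>v\<in>verts K. y v ^ k)"
    and v: "v \<in> verts K"
  shows "0 < x v"
proof (rule ccontr)
  assume nv: "\<not> 0 < x v"
  note K = uniform_hypergraphD[OF U k]
  define Z where "Z = {w \<in> verts K. x w = 0}"
  have "v \<in> Z" using nv x0[OF v] v by (auto simp: Z_def)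
  have "Z \<noteq> verts K"
  proof
    assume "Z = verts K"
    then have "(\<Sum>w\<in>verts K. x w ^ k) = 0" using k by (intro sum.neutral) (auto simp: Z_def)
    then show False using N1 by simp
  qed
  then obtain e a b where e: "e \<in> edges K" "a \<in> e" "b \<in> e" "a \<in> Z" "b \<notin> Z"
    using connected_hypergraph_crossing_edge[OF conn, of Z] \<open>v \<in> Z\<close> unfolding Z_def by blast
  note eV = K(3)[OF e(1)] and fin_e = K(4)[OF e(1)]
  define m where "m = card (e \<inter> Z)"
  \<comment> \<open>Once the zero entries on \<open>e\<close> are raised to \<epsilon>, the product
    term of \<open>e\<close> equals \<open>c * \<epsilon> ^ m\<close>; before, it was 0.\<close>
  define c where "c = (1 - \<alpha>) * k * prod x (e - Z)"
  have "m > 0" using e fin_e by (auto simp: m_def card_gt_0_iff)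
  have mk: "m < k"
    using psubset_card_mono[OF fin_e, of "e \<inter> Z"] e K(5)[OF e(1)] unfolding m_def by auto
  have xpos: "0 < x w" if "w \<in> e - Z" for w
    using that eV x0[of w] by (auto simp: Z_def less_le)
  then have c: "c > 0"
    unfolding c_def using \<alpha> k by (intro mult_pos_pos prod_pos) auto
  have "c \<le> \<rho> * m * \<epsilon>" if \<epsilon>: "0 < \<epsilon>" "\<epsilon> \<le> 1" for \<epsilon> :: real
  proof -
    define y where "y w = (if w \<in> e \<inter> Z then \<epsilon> else x w)" for w
    have xy: "x w \<le> y w" if "w \<in> verts K" for w
      using \<epsilon> that by (auto simp: y_def Z_def)
    have y0: "0 \<le> y w" if "w \<in> verts K" for w using xy[OF that] x0[OF that] by simp
    have edge_mono: "\<alpha> * (\<Sum>w\<in>f. x w ^ k) + (1 - \<alpha>) * k * prod x f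
        \<le> \<alpha> * (\<Sum>w\<in>f. y w ^ k) + (1 - \<alpha>) * k * prod y f" if "f \<in> edges K" for f
      using K(3)[OF that] x0 xy \<alpha>
      by (intro add_mono mult_left_mono sum_mono power_mono prod_mono) auto
    have "prod y e = prod y (e \<inter> Z) * prod y (e - Z)"
      using prod.union_disjoint[of "e \<inter> Z" "e - Z" y] fin_e by (simp add: Int_Diff_Un Int_Diff_disjoint)
    also have "prod y (e \<inter> Z) = \<epsilon> ^ m" by (simp add: y_def m_def)
    also have "prod y (e - Z) = prod x (e - Z)" by (intro prod.cong) (auto simp: y_def)
    finally have pye: "(1 - \<alpha>) * k * prod y e = c * \<epsilon> ^ m" by (simp add: c_def)
    have pxe: "prod x e = 0" using e fin_e by (auto simp: Z_def)
    have "\<alpha> * (\<Sum>w\<in>e. x w ^ k) \<le> \<alpha> * (\<Sum>w\<in>e. y w ^ k)"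
      using eV x0 xy \<alpha> by (intro mult_left_mono sum_mono power_mono) auto
    then have edge_e: "\<alpha> * (\<Sum>w\<in>e. x w ^ k) + (1 - \<alpha>) * k * prod x e + c * \<epsilon> ^ m
        \<le> \<alpha> * (\<Sum>w\<in>e. y w ^ k) + (1 - \<alpha>) * k * prod y e"
      using pye pxe by simp
    have "\<rho> + c * \<epsilon> ^ m \<le> (\<Sum>w\<in>verts K. vertex_form k \<alpha> (edges K) y w)"
      unfolding Fx[symmetric] sum_vertex_form[OF U k] sum.remove[OF K(2) e(1)]
      using edge_e sum_mono[OF edge_mono, of "edges K - {e}" "\<lambda>f. f"] by simp
    also have "\<dots> \<le> \<rho> * (\<Sum>w\<in>verts K. y w ^ k)" by (rule max[of y, OF y0])
    also have "(\<Sum>w\<in>verts K. y w ^ k) = (\<Sum>w\<in>verts K. x w ^ k + (if w \<in> e \<inter> Z then \<epsilon> ^ k else 0))"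
      using k by (intro sum.cong) (auto simp: y_def Z_def)
    also have "\<dots> = 1 + (\<Sum>w\<in>verts K. if w \<in> e \<inter> Z then \<epsilon> ^ k else 0)"
      using N1 by (simp add: sum.distrib)
    also have "(\<Sum>w\<in>verts K. if w \<in> e \<inter> Z then \<epsilon> ^ k else 0) = (\<Sum>w\<in>e \<inter> Z. \<epsilon> ^ k)"
      unfolding sum.inter_filter[OF K(1), symmetric] using eV by (intro sum.cong) auto
    also have "\<dots> = m * \<epsilon> ^ k" by (simp add: m_def)
    finally have "c * \<epsilon> ^ m \<le> \<rho> * m * \<epsilon> ^ k" by (simp add: algebra_simps)
    also have "\<epsilon> ^ k = \<epsilon> ^ (k - m) * \<epsilon> ^ m" using mk by (simp flip: power_add)
    finally have "c * \<epsilon> ^ m \<le> (\<rho> * m * \<epsilon> ^ (k - m)) * \<epsilon> ^ m" by (simp add: mult.assoc)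
    then have le: "c \<le> \<rho> * m * \<epsilon> ^ (k - m)" using \<epsilon> by simp
    \<comment> \<open>The sign of \<open>\<rho> * m\<close> is settled first, since replacing
      \<open>\<epsilon> ^ (k - m)\<close> by the larger \<epsilon> in the bound requires a
      nonnegative factor.\<close>
    have "0 < \<rho> * m * \<epsilon> ^ (k - m)" using c le by linarith
    then have "0 < \<rho> * m" using \<epsilon> by (simp add: zero_less_mult_iff)
    moreover have "\<epsilon> ^ (k - m) \<le> \<epsilon>"
      using power_decreasing[of 1 "k - m" \<epsilon>] \<epsilon> mk by simp
    ultimately show ?thesis using le
      by (meson mult_left_mono order_trans less_imp_le)
  qed
  then have ineq: "c \<le> \<rho> * m * \<epsilon>" if "0 < \<epsilon>" "\<epsilon> \<le> 1" for \<epsilon> :: real using that by blast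
  from ineq[of 1] c have L: "\<rho> * m > 0" by simp
  \<comment> \<open>Small enough for the linear bound to read \<open>c \<le> c / 2\<close>,
    contradicting \<open>c > 0\<close>.\<close>
  define \<epsilon> where "\<epsilon> = min 1 (c / (2 * (\<rho> * m)))"
  have "0 < \<epsilon>" "\<epsilon> \<le> 1" "\<epsilon> \<le> c / (2 * (\<rho> * m))" using c L by (auto simp: \<epsilon>_def)
  then have "\<rho> * m * \<epsilon> \<le> c / 2" using L by (simp add: field_simps)
  with ineq[OF \<open>0 < \<epsilon>\<close> \<open>\<epsilon> \<le> 1\<close>] c show False by simp
qed

text \<open>Only the entry at \<open>v\<close> is varied. As a function of this entry, the numerator
  minus \<rho> times the norm term is a polynomial with a local maximum at \<open>x v\<close>; its
  vanishing derivative is the eigenvalue equation at \<open>v\<close>, up to the factor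
  \<open>k\<close>.\<close>

lemma maximizer_eigen_equation:
  assumes U: "uniform_hypergraph k K" and k: "k \<ge> 1"
    and x0: "\<And>v. v \<in> verts K \<Longrightarrow> 0 < x v" and N1: "(\<Sum>v\<in>verts K. x v ^ k) = 1"
    and Fx: "(\<Sum>v\<in>verts K. vertex_form k \<alpha> (edges K) x v) = \<rho>"
    and max: "\<And>y. (\<And>v. v \<in> verts K \<Longrightarrow> 0 \<le> y v) \<Longrightarrow>
      (\<Sum>v\<in>verts K. vertex_form k \<alpha> (edges K) y v) \<le> \<rho> * (\<Sum>v\<in>verts K. y v ^ k)"
    and v: "v \<in> verts K"
  shows "vertex_form k \<alpha> (edges K) x v = \<rho> * x v ^ k"
proof -
  note K = uniform_hypergraphD[OF U k]
  define E1 where "E1 = {e \<in> edges K. v \<in> e}"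
  define E2 where "E2 = {e \<in> edges K. v \<notin> e}"
  define g where "g t = (\<Sum>w\<in>verts K. vertex_form k \<alpha> (edges K) (x(v := t)) w)
     - \<rho> * (\<Sum>w\<in>verts K. (x(v := t)) w ^ k)" for t
  define S where "S = (\<Sum>e\<in>E1. prod x (e - {v}))"
  define d where "d = real (vertex_degree K v)"
  \<comment> \<open>\<open>A\<close> collects everything in \<open>g t\<close> that is independent
    of \<open>t\<close>.\<close>
  define A where "A = (\<Sum>e\<in>E1. \<alpha> * (\<Sum>w\<in>e - {v}. x w ^ k))
     + (\<Sum>e\<in>E2. \<alpha> * (\<Sum>w\<in>e. x w ^ k) + (1 - \<alpha>) * k * prod x e)
     - \<rho> * (\<Sum>w\<in>verts K - {v}. x w ^ k)"
  have split: "edges K = E1 \<union> E2" "E1 \<inter> E2 = {}" and fin: "finite E1" "finite E2"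
    using K(2) by (auto simp: E1_def E2_def)
  have g_eq: "g t = A + (\<alpha> * d - \<rho>) * t ^ k + (1 - \<alpha>) * k * S * t" for t
  proof -
    have "(\<Sum>w\<in>verts K. (x(v := t)) w ^ k) = t ^ k + (\<Sum>w\<in>verts K - {v}. x w ^ k)"
      unfolding sum.remove[OF K(1) v] by (auto intro!: sum.cong)
    moreover have "(\<Sum>e\<in>E2. \<alpha> * (\<Sum>w\<in>e. (x(v := t)) w ^ k) + (1 - \<alpha>) * k * prod (x(v := t)) e)
       = (\<Sum>e\<in>E2. \<alpha> * (\<Sum>w\<in>e. x w ^ k) + (1 - \<alpha>) * k * prod x e)"
    proof (rule sum.cong[OF refl])
      fix e assume "e \<in> E2"
      then have "(\<Sum>w\<in>e. (x(v := t)) w ^ k) = (\<Sum>w\<in>e. x w ^ k)" "prod (x(v := t)) e = prod x e"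
        by (auto simp: E2_def intro!: sum.cong prod.cong)
      then show "\<alpha> * (\<Sum>w\<in>e. (x(v := t)) w ^ k) + (1 - \<alpha>) * k * prod (x(v := t)) e
       = \<alpha> * (\<Sum>w\<in>e. x w ^ k) + (1 - \<alpha>) * k * prod x e" by simp
    qed
    moreover have "(\<Sum>e\<in>E1. \<alpha> * (\<Sum>w\<in>e. (x(v := t)) w ^ k) + (1 - \<alpha>) * k * prod (x(v := t)) e)
       = (\<Sum>e\<in>E1. \<alpha> * (\<Sum>w\<in>e - {v}. x w ^ k) + \<alpha> * t ^ k
           + (1 - \<alpha>) * k * t * prod x (e - {v}))"
    proof (rule sum.cong[OF refl])
      fix e assume "e \<in> E1"
      then have e: "finite e" "v \<in> e" using K(4) by (auto simp: E1_def)
      have "(\<Sum>w\<in>e. (x(v := t)) w ^ k) = t ^ k + (\<Sum>w\<in>e - {v}. x w ^ k)"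
        unfolding sum.remove[OF e] by (auto intro!: sum.cong)
      moreover have "prod (x(v := t)) e = t * prod x (e - {v})"
        unfolding prod.remove[OF e] by (auto intro!: prod.cong)
      ultimately show "\<alpha> * (\<Sum>w\<in>e. (x(v := t)) w ^ k) + (1 - \<alpha>) * k * prod (x(v := t)) e
       = \<alpha> * (\<Sum>w\<in>e - {v}. x w ^ k) + \<alpha> * t ^ k + (1 - \<alpha>) * k * t * prod x (e - {v})"
        by (simp add: algebra_simps)
    qed
    moreover have "(\<Sum>e\<in>E1. \<alpha> * (\<Sum>w\<in>e - {v}. x w ^ k) + \<alpha> * t ^ k
           + (1 - \<alpha>) * k * t * prod x (e - {v}))
       = (\<Sum>e\<in>E1. \<alpha> * (\<Sum>w\<in>e - {v}. x w ^ k)) + d * (\<alpha> * t ^ k) + (1 - \<alpha>) * k * t * S"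
      by (simp add: sum.distrib S_def d_def E1_def vertex_degree_def flip: sum_distrib_left)
    ultimately show ?thesis
      unfolding g_def sum_vertex_form[OF U k]
      unfolding split(1) sum.union_disjoint[OF fin split(2)]
      by (simp add: A_def algebra_simps del: fun_upd_apply)
  qed
  have "(g has_real_derivative
      (\<alpha> * d - \<rho>) * (k * x v ^ (k - 1)) + (1 - \<alpha>) * k * S) (at (x v))"
    unfolding g_eq[abs_def] by (auto intro!: derivative_eq_intros)
  then have "(\<alpha> * d - \<rho>) * (k * x v ^ (k - 1)) + (1 - \<alpha>) * k * S = 0"
  proof (rule DERIV_local_max)
    \<comment> \<open>Taking \<open>x v\<close> itself as the radius keeps \<open>t\<close>
      positive, so the perturbed vector stays admissible for \<open>max\<close>. There
      \<open>g\<close> is at most 0, and it equals 0 at \<open>x v\<close>.\<close>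
    show "0 < x v" using x0[OF v] .
    show "\<forall>t. \<bar>x v - t\<bar> < x v \<longrightarrow> g t \<le> g (x v)"
    proof (intro allI impI)
      fix t assume "\<bar>x v - t\<bar> < x v"
      then have "0 \<le> (x(v := t)) w" if "w \<in> verts K" for w using x0[OF that] by auto
      then have "g t \<le> 0" using max[of "x(v := t)"] by (simp add: g_def del: fun_upd_apply)
      also have "0 = g (x v)" using N1 Fx by (simp add: g_def)
      finally show "g t \<le> g (x v)" .
    qed
  qed
  then have "real k * (\<alpha> * d * x v ^ (k - 1) + (1 - \<alpha>) * S) = real k * (\<rho> * x v ^ (k - 1))"
    by (simp add: algebra_simps)
  then have "\<alpha> * d * x v ^ (k - 1) + (1 - \<alpha>) * S = \<rho> * x v ^ (k - 1)" using k by simp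
  then have "vertex_form k \<alpha> (edges K) x v = x v * (\<rho> * x v ^ (k - 1))"
    by (simp add: vertex_form_factor[OF U k] S_def E1_def d_def)
  then show ?thesis using k by (simp add: power_eq_if)
qed

text \<open>Identifies the maximum of the Rayleigh quotient with the spectral radius: the positive
  maximizer is an eigenvector for it, and no complex eigenvalue has larger modulus. The third
  conclusion is what bounds a spectral radius from below by a test vector.\<close>

lemma perron_vector:
  assumes U: "uniform_hypergraph k K" and k: "k \<ge> 1" and conn: "connected_hypergraph K"
    and \<alpha>: "0 \<le> \<alpha>" "\<alpha> < 1"
  obtains x where "\<And>v. v \<in> verts K \<Longrightarrow> 0 < x v"
    and "\<And>v. v \<in> verts K \<Longrightarrow>
      vertex_form k \<alpha> (edges K) x v = alpha_spectral_radius k \<alpha> K * x v ^ k"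
    and "\<And>y. (\<And>v. v \<in> verts K \<Longrightarrow> 0 \<le> y v) \<Longrightarrow>
      (\<Sum>v\<in>verts K. vertex_form k \<alpha> (edges K) y v)
        \<le> alpha_spectral_radius k \<alpha> K * (\<Sum>v\<in>verts K. y v ^ k)"
proof -
  note K = uniform_hypergraphD[OF U k]
  let ?V = "verts K" and ?N = "\<lambda>y. \<Sum>v\<in>verts K. y v ^ k :: real"
  let ?F = "\<lambda>y. \<Sum>v\<in>verts K. vertex_form k \<alpha> (edges K) y v"
  have ne: "?V \<noteq> {}" using conn by (simp add: connected_hypergraph_def)
  obtain x \<rho> where x0: "\<And>v. v \<in> ?V \<Longrightarrow> 0 \<le> x v" and N1: "?N x = 1" and Fx: "?F x = \<rho>"
    and max: "\<And>y. (\<And>v. v \<in> ?V \<Longrightarrow> 0 \<le> y v) \<Longrightarrow> ?F y \<le> \<rho> * ?N y"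
    using exists_maximizer[OF U k ne, of \<alpha> thesis] by blast
  have pos: "0 < x v" if "v \<in> ?V" for v
    using maximizer_positive[OF U k conn \<alpha> x0 N1 Fx max that] .
  have eigen: "vertex_form k \<alpha> (edges K) x v = \<rho> * x v ^ k" if "v \<in> ?V" for v
    using maximizer_eigen_equation[OF U k pos N1 Fx max that] .
  have "\<rho> \<ge> 0"
    unfolding Fx[symmetric] vertex_form_def using \<alpha> x0 K(3)
    by (intro sum_nonneg add_nonneg_nonneg mult_nonneg_nonneg prod_nonneg zero_le_power) auto
  have ev: "tensor_eigenvalue k ?V (alpha_tensor k \<alpha> K) (of_real \<rho>)"
    unfolding tensor_eigenvalue_def
  proof (intro exI[of _ "\<lambda>w. complex_of_real (x w)"] conjI ballI)
    show "\<exists>v\<in>?V. complex_of_real (x v) \<noteq> 0" using ne pos by fastforce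
    fix v assume v: "v \<in> ?V"
    have "x v * (\<alpha> * vertex_degree K v * x v ^ (k - 1)
        + (1 - \<alpha>) * (\<Sum>e | e \<in> edges K \<and> v \<in> e. prod x (e - {v}))) = x v * (\<rho> * x v ^ (k - 1))"
      using eigen[OF v] k unfolding vertex_form_factor[OF U k] by (simp add: power_eq_if)
    then have *: "\<alpha> * vertex_degree K v * x v ^ (k - 1)
        + (1 - \<alpha>) * (\<Sum>e | e \<in> edges K \<and> v \<in> e. prod x (e - {v})) = \<rho> * x v ^ (k - 1)"
      using pos[OF v] by (simp only: mult_cancel_left) auto
    show "tensor_apply k ?V (alpha_tensor k \<alpha> K) (\<lambda>w. complex_of_real (x w)) v
        = of_real \<rho> * complex_of_real (x v) ^ (k - 1)"
      unfolding alpha_tensor_apply[OF U k v]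
      using arg_cong[OF *, of complex_of_real] by simp
  qed
  \<comment> \<open>Since the tensor has nonnegative entries, the triangle inequality turns the
    eigenvalue equations of \<open>z\<close> into inequalities for the vector of moduli, which is
    then a test vector with Rayleigh quotient at least \<open>cmod \<mu>\<close>.\<close>
  have bound: "cmod \<mu> \<le> \<rho>" if \<mu>: "tensor_eigenvalue k ?V (alpha_tensor k \<alpha> K) \<mu>" for \<mu>
  proof -
    obtain z a where a: "a \<in> ?V" "z a \<noteq> 0" and
      z: "\<And>v. v \<in> ?V \<Longrightarrow> tensor_apply k ?V (alpha_tensor k \<alpha> K) z v = \<mu> * z v ^ (k - 1)"
      using \<mu> unfolding tensor_eigenvalue_def by blast
    let ?y = "\<lambda>w. cmod (z w)"
    have "cmod \<mu> * ?y v ^ k \<le> vertex_form k \<alpha> (edges K) ?y v" if v: "v \<in> ?V" for v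
    proof -
      have "cmod \<mu> * ?y v ^ (k - 1) = cmod (of_real \<alpha> * of_nat (vertex_degree K v) * z v ^ (k - 1)
          + of_real (1 - \<alpha>) * (\<Sum>e | e \<in> edges K \<and> v \<in> e. \<Prod>w\<in>e - {v}. z w))"
        using z[OF v] unfolding alpha_tensor_apply[OF U k v] by (simp add: norm_mult norm_power)
      also have "\<dots> \<le> cmod (of_real \<alpha> * of_nat (vertex_degree K v) * z v ^ (k - 1))
          + cmod (of_real (1 - \<alpha>) * (\<Sum>e | e \<in> edges K \<and> v \<in> e. \<Prod>w\<in>e - {v}. z w))"
        by (rule norm_triangle_ineq)
      also have "\<dots> \<le> \<alpha> * vertex_degree K v * ?y v ^ (k - 1)
          + (1 - \<alpha>) * (\<Sum>e | e \<in> edges K \<and> v \<in> e. prod ?y (e - {v}))"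
      proof (rule add_mono)
        show "cmod (of_real \<alpha> * of_nat (vertex_degree K v) * z v ^ (k - 1))
          \<le> \<alpha> * vertex_degree K v * ?y v ^ (k - 1)"
          using \<alpha> by (simp add: norm_mult norm_power)
        have "cmod (\<Sum>e | e \<in> edges K \<and> v \<in> e. \<Prod>w\<in>e - {v}. z w)
          \<le> (\<Sum>e | e \<in> edges K \<and> v \<in> e. prod ?y (e - {v}))"
          by (rule order_trans[OF norm_sum]) (simp add: prod_norm)
        then show "cmod (of_real (1 - \<alpha>) * (\<Sum>e | e \<in> edges K \<and> v \<in> e. \<Prod>w\<in>e - {v}. z w))
          \<le> (1 - \<alpha>) * (\<Sum>e | e \<in> edges K \<and> v \<in> e. prod ?y (e - {v}))"
          unfolding norm_mult norm_of_real using \<alpha> by (intro mult_mono) auto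
      qed
      finally have "?y v * (cmod \<mu> * ?y v ^ (k - 1)) \<le> vertex_form k \<alpha> (edges K) ?y v"
        unfolding vertex_form_factor[OF U k] by (rule mult_left_mono) simp
      then show ?thesis using k by (simp add: power_eq_if mult.left_commute)
    qed
    then have "cmod \<mu> * ?N ?y \<le> ?F ?y"
      unfolding sum_distrib_left by (rule sum_mono)
    also have "\<dots> \<le> \<rho> * ?N ?y" by (rule max) simp
    finally have "cmod \<mu> * ?N ?y \<le> \<rho> * ?N ?y" .
    moreover have "?N ?y > 0" using K(1) a by (intro sum_pos2[of _ a]) auto
    ultimately show ?thesis by simp
  qed
  have "alpha_spectral_radius k \<alpha> K = \<rho>"
    unfolding alpha_spectral_radius_def
    by (rule Greatest_equality) (use ev \<open>\<rho> \<ge> 0\<close> bound in \<open>auto intro!: exI[of _ "complex_of_real \<rho>"]\<close>)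
  with pos eigen max that show thesis by blast
qed

section \<open>Loose paths\<close>

lemma vertex_form_cong:
  assumes "v \<in> V" and "\<And>w. w \<in> V \<Longrightarrow> x w = y w"
    and "\<And>e. e \<in> E \<Longrightarrow> v \<in> e \<Longrightarrow> e \<subseteq> V"
  shows "vertex_form k \<alpha> E x v = vertex_form k \<alpha> E y v"
proof -
  have "prod x e = prod y e" if "e \<in> E" "v \<in> e" for e
    using assms(2,3) that by (intro prod.cong) auto
  then show ?thesis unfolding vertex_form_def using assms(1,2) by (intro sum.cong) auto
qed

lemma vertex_form_union:
  assumes "finite E" and "finite F" and "E \<inter> F = {}"
  shows "vertex_form k \<alpha> (E \<union> F) x v = vertex_form k \<alpha> E x v + vertex_form k \<alpha> F x v"
proof -
  have "{e. e \<in> E \<union> F \<and> v \<in> e} = {e. e \<in> E \<and> v \<in> e} \<union> {e. e \<in> F \<and> v \<in> e}" by blast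
  then show ?thesis
    unfolding vertex_form_def using assms by (simp add: sum.union_disjoint disjoint_iff)
qed

lemma vertex_form_notin:
  assumes "\<And>e. e \<in> E \<Longrightarrow> v \<notin> e"
  shows "vertex_form k \<alpha> E x v = 0"
proof -
  have none: "{e. e \<in> E \<and> v \<in> e} = {}" using assms by blast
  show ?thesis unfolding vertex_form_def none by simp
qed

lemma vertex_form_insert:
  assumes "finite E" and "f \<notin> E"
  shows "vertex_form k \<alpha> (insert f E) x v =
    (if v \<in> f then \<alpha> * x v ^ k + (1 - \<alpha>) * prod x f else 0) + vertex_form k \<alpha> E x v"
proof -
  have "{e. e \<in> {f} \<and> v \<in> e} = (if v \<in> f then {f} else {})" by auto
  then have "vertex_form k \<alpha> {f} x v =
      (if v \<in> f then \<alpha> * x v ^ k + (1 - \<alpha>) * prod x f else 0)"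
    unfolding vertex_form_def by simp
  then show ?thesis using vertex_form_union[of "{f}" E k \<alpha> x v] assms by simp
qed

text \<open>Loose paths without the indexed lists: a path grows at its root, the new edge
  \<open>f\<close> running from the new root \<open>u\<close> to the old root \<open>u'\<close>.
  Induction thus proceeds from the free end towards the root, like the recursion of the path
  coefficients.\<close>

inductive rooted_path :: "nat \<Rightarrow> 'a \<Rightarrow> 'a set set \<Rightarrow> 'a set \<Rightarrow> nat \<Rightarrow> bool" for k where
  rooted_path_0: "rooted_path k u {} {u} 0"
| rooted_path_Suc: "rooted_path k u' E V d \<Longrightarrow> f \<inter> V = {u'} \<Longrightarrow> u \<in> f \<Longrightarrow> u \<noteq> u' \<Longrightarrow> card f = k \<Longrightarrow>
    finite f \<Longrightarrow> rooted_path k u (insert f E) (V \<union> f) (Suc d)"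

lemma rooted_path_facts:
  assumes "rooted_path k u E V d"
  shows "u \<in> V" and "finite V" and "finite E" and "\<And>e. e \<in> E \<Longrightarrow> e \<subseteq> V \<and> card e = k"
  using assms by (induction) auto

lemma rooted_path_connected:
  assumes "rooted_path k u E V d" and "v \<in> V"
  shows "(u, v) \<in> {(a, b). \<exists>e\<in>E. a \<in> e \<and> b \<in> e}\<^sup>*"
  using assms
proof (induction arbitrary: v)
  case (rooted_path_Suc u' E V d f u)
  let ?R = "{(a, b). \<exists>e\<in>insert f E. a \<in> e \<and> b \<in> e}"
  show ?case
  proof (cases "v \<in> V")
    case True
    have "{(a, b). \<exists>e\<in>E. a \<in> e \<and> b \<in> e}\<^sup>* \<subseteq> ?R\<^sup>*" by (rule rtrancl_mono) auto
    then have "(u', v) \<in> ?R\<^sup>*" using rooted_path_Suc.IH[OF True] by blast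
    moreover have "(u, u') \<in> ?R" using rooted_path_Suc.hyps by auto
    ultimately show ?thesis by (rule converse_rtrancl_into_rtrancl[rotated])
  next
    case False
    then have "(u, v) \<in> ?R" using rooted_path_Suc.hyps rooted_path_Suc.prems by auto
    then show ?thesis by blast
  qed
qed simp

text \<open>Removing the edge at the root leaves a loose path whose root is the next joint. This is
  the step that translates indexed loose paths into \<open>rooted_path\<close>.\<close>

lemma loose_path_tailE:
  assumes P: "loose_path k P vs (f # es)"
  obtains P' vs' where "loose_path k P' vs' es" and "f \<inter> verts P' = {hd vs'}"
    and "hd vs \<in> f" and "hd vs \<noteq> hd vs'" and "card f = k"
    and "verts P = verts P' \<union> f" and "edges P = insert f (edges P')"
proof -
  obtain v0 v1 vs' where vs: "vs = v0 # v1 # vs'"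
    using P unfolding loose_path_def by (metis Suc_eq_plus1 length_Suc_conv list.size(4))
  note P = P[unfolded loose_path_def vs]
  have len: "length vs' = length es" using P by simp
  have V: "verts P = insert v0 (\<Union>(set (f # es)))" using P by simp
  have E: "edges P = set (f # es)" using P by blast
  have dist: "distinct es" using P by simp
  have card: "\<forall>e\<in>set (f # es). card e = k" using P by blast
  have adj: "(f # es) ! i \<inter> es ! i = {(v1 # vs') ! i}" if "i < length es" for i
  proof -
    have "\<forall>i. i + 1 < length (f # es) \<longrightarrow>
        (f # es) ! i \<inter> (f # es) ! (i + 1) = {(v0 # v1 # vs') ! (i + 1)}"
      using P by blast
    from this[rule_format, of i] that show ?thesis by simp
  qed
  have far: "(f # es) ! i \<inter> (f # es) ! j = {}" if "i + 2 \<le> j" "j < Suc (length es)" for i j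
  proof -
    have "\<forall>i j. i + 2 \<le> j \<and> j < length (f # es) \<longrightarrow> (f # es) ! i \<inter> (f # es) ! j = {}"
      using P by blast
    from this[rule_format, of i j] that show ?thesis by simp
  qed
  have first: "v0 \<in> f" "v0 \<noteq> v1" using P by simp_all
  have last: "(v1 # vs') ! length es \<in> last (f # es) - {(v0 # v1 # vs') ! length es}"
    using P by simp
  have far': "es ! i \<inter> es ! j = {}" if "i + 2 \<le> j" "j < length es" for i j
    using far[of "Suc i" "Suc j"] that by simp
  have adj': "es ! i \<inter> es ! (i + 1) = {vs' ! i}" if "i + 1 < length es" for i
    using adj[of "Suc i"] that by simp
  have last': "vs' ! (length es - 1) \<in> last es - {(v1 # vs') ! (length es - 1)}" if "es \<noteq> []"
    using last that by (simp add: nth_Cons')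
  have f_hd: "f \<inter> es ! 0 = {v1}" if "es \<noteq> []"
    using adj[of 0] that by simp
  have v1: "v1 \<in> f"
  proof (cases "es = []")
    case True
    then show ?thesis using last by simp
  next
    case False
    then show ?thesis using f_hd by blast
  qed
  have v1_hd: "v1 \<in> hd es" if "es \<noteq> []"
    using f_hd[OF that] hd_conv_nth[OF that] by blast
  \<comment> \<open>The tail must again have two different vertices on its first edge. If this edge
    is the only one, the condition at the far end says so; otherwise \<open>vs' ! 0\<close> lies on
    the second edge of the tail, which is disjoint from \<open>f\<close>, while \<open>v1\<close>
    lies in \<open>f\<close>.\<close>
  have ne: "v1 \<noteq> vs' ! 0" if "es \<noteq> []"
  proof (cases "length es = 1")
    case True
    then show ?thesis using last'[OF that] by auto
  next
    case False
    with that have "1 < length es" by (cases es) auto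
    then have "es ! 0 \<inter> es ! 1 = {vs' ! 0}" "f \<inter> es ! 1 = {}"
      using adj'[of 0] far[of 0 2] by simp_all
    then show ?thesis using v1 by blast
  qed
  define P' where "P' = \<lparr>verts = insert v1 (\<Union>(set es)), edges = set es\<rparr>"
  have P': "verts P' = insert v1 (\<Union>(set es))" "edges P' = set es" by (simp_all add: P'_def)
  have tail: "loose_path k P' (v1 # vs') es"
    unfolding loose_path_def
  proof (intro conjI)
    show "length (v1 # vs') = length es + 1" by (simp add: len)
    show "verts P' = insert (hd (v1 # vs')) (\<Union>(set es))" by (simp add: P')
    show "edges P' = set es" by (simp add: P')
    show "distinct es" "\<forall>e\<in>set es. card e = k" using dist card by simp_all
    show "\<forall>i. i + 1 < length es \<longrightarrow> es ! i \<inter> es ! (i + 1) = {(v1 # vs') ! (i + 1)}"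
      using adj' by simp
    show "\<forall>i j. i + 2 \<le> j \<and> j < length es \<longrightarrow> es ! i \<inter> es ! j = {}"
      using far' by blast
    show "es \<noteq> [] \<longrightarrow> (v1 # vs') ! 0 \<in> hd es - {(v1 # vs') ! 1} \<and>
        (v1 # vs') ! length es \<in> last es - {(v1 # vs') ! (length es - 1)}"
      using v1_hd ne last' by simp
  qed
  have "f \<inter> e \<subseteq> {v1}" if e: "e \<in> set es" for e
  proof -
    obtain j where j: "j < length es" "e = es ! j" using e by (metis in_set_conv_nth)
    show ?thesis
    proof (cases j)
      case 0
      then have "f \<inter> e = {v1}" using f_hd j by (cases es) simp_all
      then show ?thesis by blast
    next
      case (Suc i)
      then have "f \<inter> e = {}" using far[of 0 "Suc j"] j by simp
      then show ?thesis by blast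
    qed
  qed
  then have "f \<inter> verts P' = {v1}" unfolding P' using v1 by blast
  moreover have "verts P = verts P' \<union> f" unfolding P' V using first v1 by auto
  moreover have "edges P = insert f (edges P')" unfolding P' E by simp
  moreover have "card f = k" using card by simp
  ultimately show thesis using that[OF tail] first by (simp add: vs)
qed

lemma loose_path_imp_rooted_path:
  assumes "loose_path k P vs es" and "k \<ge> 1"
  shows "rooted_path k (hd vs) (edges P) (verts P) (length es)"
  using assms(1)
proof (induction es arbitrary: P vs)
  case Nil
  then have "edges P = {}" "verts P = {hd vs}" by (simp_all add: loose_path_def)
  then show ?case using rooted_path_0[of k "hd vs"] by simp
next
  case (Cons f es)
  obtain P' vs' where t: "loose_path k P' vs' es" "f \<inter> verts P' = {hd vs'}" "hd vs \<in> f"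
    "hd vs \<noteq> hd vs'" "card f = k" "verts P = verts P' \<union> f" "edges P = insert f (edges P')"
    using loose_path_tailE[OF Cons.prems] .
  have "finite f" using t(5) assms(2) by (metis card.infinite not_one_le_zero)
  from rooted_path_Suc[OF Cons.IH[OF t(1)] t(2-5) this] show ?case by (simp add: t(6,7))
qed

section \<open>Eigenvectors along a pendant path\<close>

text \<open>If \<open>x\<close> solves the eigenvalue equations for \<open>\<rho>\<close> at all vertices of a pendant path except its root
  \<open>u\<close>, then the equation at \<open>u\<close> sees the path only through the term \<open>(\<rho> - \<alpha> - path_coeff k \<alpha> \<rho> d) * x u ^ k\<close>,
  where \<open>d\<close> is the length of the path.\<close>

fun path_coeff :: "nat \<Rightarrow> real \<Rightarrow> real \<Rightarrow> nat \<Rightarrow> real" where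
  "path_coeff k \<alpha> \<rho> 0 = \<rho> - \<alpha>"
| "path_coeff k \<alpha> \<rho> (Suc d) =
    \<rho> - 2 * \<alpha> - (1 - \<alpha>) ^ k / (\<rho> - \<alpha>) ^ (k - 2) / path_coeff k \<alpha> \<rho> d"

declare path_coeff.simps(2) [simp del]

text \<open>The recursion applies a strictly increasing map on the positive reals, so the initial
  drop from index 0 to index 1 propagates.\<close>

lemma path_coeff_strict_decreasing:
  assumes pos: "\<And>i. i < n \<Longrightarrow> path_coeff k \<alpha> \<rho> i > 0" and \<alpha>: "0 \<le> \<alpha>" "\<alpha> < 1" and "i < j" "j \<le> n"
  shows "path_coeff k \<alpha> \<rho> j < path_coeff k \<alpha> \<rho> i"
proof -
  let ?b = "path_coeff k \<alpha> \<rho>" and ?M = "(1 - \<alpha>) ^ k / (\<rho> - \<alpha>) ^ (k - 2)"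
  have "0 < \<rho> - \<alpha>" using pos[of 0] assms by simp
  then have M: "0 < ?M" using \<alpha> by simp
  have step: "?b (Suc m) < ?b m" if "m < n" for m
    using that
  proof (induction m)
    case 0
    have "0 < ?M / ?b 0" by (rule divide_pos_pos[OF M pos[OF 0]])
    then show ?case using \<alpha> by (simp add: path_coeff.simps(2))
  next
    case (Suc m)
    then have "?M / ?b m < ?M / ?b (Suc m)"
      using M pos[of m] pos[of "Suc m"] by (intro divide_strict_left_mono mult_pos_pos) auto
    then show ?case by (simp add: path_coeff.simps(2))
  qed
  show ?thesis using \<open>i < j\<close> \<open>j \<le> n\<close>
  proof (induction j)
    case (Suc j)
    then show ?case using step[of j] by (cases "i = j") auto
  qed simp
qed

lemma rooted_path_cases_edge:
  assumes "f \<inter> V = {u'}" and "u \<in> f" and "u \<noteq> u'" and "finite f" and "card f = k"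
  defines "R \<equiv> f - {u, u'}"
  shows "f = insert u (insert u' R)" and "u \<notin> insert u' R" and "u' \<notin> R" and "finite R"
    and "card R = k - 2" and "u \<notin> V" and "R \<inter> V = {}"
proof -
  have u': "u' \<in> f" using assms(1) by blast
  then show "f = insert u (insert u' R)" "u \<notin> insert u' R" "u' \<notin> R" "finite R" "u \<notin> V" "R \<inter> V = {}"
    using assms(1-4) unfolding R_def by blast+
  show "card R = k - 2"
    unfolding R_def using assms(2-5) u' by (subst card_Diff_subset) auto
qed

text \<open>Eliminates the edge product \<open>p\<close>. With \<open>a = 1 - \<alpha>\<close>,
  \<open>r = \<rho> - \<alpha>\<close>, \<open>b\<close> the coefficient of the shorter path and
  \<open>X\<close> the \<open>k\<close>-th power of the root entry, the left side is the
  \<open>k\<close>-th power of the product over an edge after inserting the equations at its other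
  vertices; cancelling \<open>p ^ (k - 1)\<close> leaves the recursion. One direction analyses an
  eigenvector, the other constructs one.\<close>

lemma edge_product_iff:
  fixes a b p r X :: real
  assumes "a > 0" and "p > 0" and "k \<ge> 2"
  shows "p ^ k = X * (a * p / b) * (a * p / r) ^ (k - 2) \<longleftrightarrow> a * p = a ^ k / r ^ (k - 2) / b * X"
proof -
  define m where "m = k - 2"
  have k: "k = Suc (Suc m)" using assms(3) by (simp add: m_def)
  have 1: "p ^ k = p * (p * p ^ m)" by (simp add: k)
  have 2: "X * (a * p / b) * (a * p / r) ^ m = X * a * a ^ m / (b * r ^ m) * (p * p ^ m)"
    by (simp add: power_divide power_mult_distrib)
  have 3: "a ^ k / r ^ m / b * X = a * (X * a * a ^ m / (b * r ^ m))"
    by (simp add: k mult_ac)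
  show ?thesis
    unfolding m_def[symmetric] 1 2 3 mult_cancel_left mult_cancel_right using assms(1,2) by auto
qed

text \<open>Induction from the free end. The equations at the vertices of the first edge other than
  the root express their entries through the edge product, which \<open>edge_product_iff\<close>
  eliminates. Positivity of a coefficient comes from the equation at the root of the corresponding
  subpath; no equation is assumed at \<open>u\<close>, so index \<open>d\<close> is left
  out.\<close>

lemma rooted_path_eigenvector:
  assumes "rooted_path k u E V d" and k: "k \<ge> 3" and \<alpha>: "0 \<le> \<alpha>" "\<alpha> < 1"
    and "\<And>v. v \<in> V \<Longrightarrow> 0 < x v"
    and "\<And>v. v \<in> V - {u} \<Longrightarrow> vertex_form k \<alpha> E x v = \<rho> * x v ^ k"
  shows "(\<forall>i<d. 0 < path_coeff k \<alpha> \<rho> i)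
    \<and> vertex_form k \<alpha> E x u = (\<rho> - \<alpha> - path_coeff k \<alpha> \<rho> d) * x u ^ k"
  using assms(1,5,6)
proof (induction)
  case (rooted_path_0 u)
  then show ?case by (simp add: vertex_form_def)
next
  case (rooted_path_Suc u' E V d f u)
  let ?b = "path_coeff k \<alpha> \<rho>"
  note F = rooted_path_facts[OF rooted_path_Suc.hyps(1)]
  define R where "R = f - {u, u'}"
  note e = rooted_path_cases_edge[OF rooted_path_Suc.hyps(2,3,4,6,5), folded R_def]
  have fE: "f \<notin> E" using F(4)[of f] e(1,6) by blast
  note ins = vertex_form_insert[OF F(3) fE, of k \<alpha> x]
  note pos = rooted_path_Suc.prems(1) and eq = rooted_path_Suc.prems(2)
  have IH: "\<forall>i<d. 0 < ?b i" "vertex_form k \<alpha> E x u' = (\<rho> - \<alpha> - ?b d) * x u' ^ k"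
  proof -
    have "vertex_form k \<alpha> E x v = \<rho> * x v ^ k" if v: "v \<in> V - {u'}" for v
    proof -
      have "v \<notin> f" "v \<in> V \<union> f - {u}" using v rooted_path_Suc.hyps(2) e(6) by blast+
      then show ?thesis using eq[of v] ins[of v] by simp
    qed
    then show "\<forall>i<d. 0 < ?b i" "vertex_form k \<alpha> E x u' = (\<rho> - \<alpha> - ?b d) * x u' ^ k"
      using rooted_path_Suc.IH pos by auto
  qed
  have mem: "u \<in> f" "u' \<in> f" "u' \<in> V \<union> f - {u}" using rooted_path_Suc.hyps(2-4) by auto
  define p where "p = prod x f"
  have p: "p > 0" unfolding p_def using pos by (intro prod_pos) auto
  have "x u' > 0" "x u > 0" using pos mem by auto
  have eq_u': "?b d * x u' ^ k = (1 - \<alpha>) * p"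
    using eq[OF mem(3)] mem(2) IH(2) ins[of u'] by (simp add: p_def algebra_simps)
  have bd: "?b d > 0"
  proof -
    have "0 < ?b d * x u' ^ k" unfolding eq_u' using p \<alpha> by simp
    then show ?thesis using \<open>x u' > 0\<close> by (simp add: zero_less_mult_iff)
  qed
  have eq_R: "(\<rho> - \<alpha>) * x v ^ k = (1 - \<alpha>) * p" if v: "v \<in> R" for v
  proof -
    have "vertex_form k \<alpha> E x v = 0" using v F(4) e(7) by (intro vertex_form_notin) blast
    moreover have "v \<in> f" "v \<in> V \<union> f - {u}" using v by (auto simp: R_def)
    ultimately show ?thesis using eq[of v] ins[of v] by (simp add: p_def algebra_simps)
  qed
  \<comment> \<open>Here \<open>k \<ge> 3\<close> matters: \<open>f\<close> has an inner vertex of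
    degree one, and its equation forces \<rho> above \<alpha>.\<close>
  have ra: "\<rho> - \<alpha> > 0"
  proof -
    have "R \<noteq> {}" using e(5) k by auto
    then obtain v where v: "v \<in> R" by blast
    then have "x v > 0" using pos by (auto simp: R_def)
    moreover have "0 < (\<rho> - \<alpha>) * x v ^ k" using eq_R[OF v] p \<alpha> by simp
    ultimately show ?thesis by (simp add: zero_less_mult_iff)
  qed
  have "p ^ k = x u ^ k * x u' ^ k * (\<Prod>v\<in>R. x v ^ k)"
  proof -
    have "prod x f = x u * (x u' * prod x R)"
      by (subst e(1)) (use e(2-4) in simp)
    then show ?thesis by (simp add: p_def prod_power_distrib power_mult_distrib mult.assoc)
  qed
  also have "(\<Prod>v\<in>R. x v ^ k) = (\<Prod>v\<in>R. (1 - \<alpha>) * p / (\<rho> - \<alpha>))"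
    using eq_R ra by (intro prod.cong) (auto simp: field_simps)
  also have "\<dots> = ((1 - \<alpha>) * p / (\<rho> - \<alpha>)) ^ (k - 2)" by (simp add: e(5))
  also have "x u' ^ k = (1 - \<alpha>) * p / ?b d" using eq_u' bd by (simp add: field_simps)
  finally have "p ^ k = x u ^ k * ((1 - \<alpha>) * p / ?b d) * ((1 - \<alpha>) * p / (\<rho> - \<alpha>)) ^ (k - 2)" .
  then have key: "(1 - \<alpha>) * p = (1 - \<alpha>) ^ k / (\<rho> - \<alpha>) ^ (k - 2) / ?b d * x u ^ k"
    using p \<alpha> k by (subst (asm) edge_product_iff) auto
  have "vertex_form k \<alpha> E x u = 0" using F(4) e(6) by (intro vertex_form_notin) blast
  then have "vertex_form k \<alpha> (insert f E) x u = \<alpha> * x u ^ k + (1 - \<alpha>) * p"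
    using ins[of u] mem by (simp add: p_def)
  also have "\<dots> = (\<rho> - \<alpha> - ?b (Suc d)) * x u ^ k"
    unfolding key by (simp add: path_coeff.simps(2) algebra_simps)
  finally show ?case using IH(1) bd less_Suc_eq by auto
qed

text \<open>The converse construction: for any prescribed root entry the equations are solved edge
  by edge, moving away from the root.\<close>

lemma rooted_path_extend:
  assumes "rooted_path k u E V d" and k: "k \<ge> 3" and \<alpha>: "0 \<le> \<alpha>" "\<alpha> < 1"
    and "\<And>i. i < d \<Longrightarrow> 0 < path_coeff k \<alpha> \<rho> i" and "0 < c"
  obtains y where "y u = c" and "\<And>v. v \<in> V \<Longrightarrow> 0 < y v"
    and "\<And>v. v \<in> V - {u} \<Longrightarrow> vertex_form k \<alpha> E y v = \<rho> * y v ^ k"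
    and "vertex_form k \<alpha> E y u = (\<rho> - \<alpha> - path_coeff k \<alpha> \<rho> d) * c ^ k"
  using assms(1,5,6)
proof (induction arbitrary: c thesis)
  case (rooted_path_0 u)
  then show ?case by (simp add: vertex_form_def)
next
  case (rooted_path_Suc u' E V d f u)
  let ?b = "path_coeff k \<alpha> \<rho>" and ?M = "(1 - \<alpha>) ^ k / (\<rho> - \<alpha>) ^ (k - 2)"
  note F = rooted_path_facts[OF rooted_path_Suc.hyps(1)]
  define R where "R = f - {u, u'}"
  note e = rooted_path_cases_edge[OF rooted_path_Suc.hyps(2,3,4,6,5), folded R_def]
  have fE: "f \<notin> E" using F(4)[of f] e(1,6) by blast
  note b = rooted_path_Suc.prems(2) and c = rooted_path_Suc.prems(3)
  have ra: "\<rho> - \<alpha> > 0" using b[of 0] by simp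
  have bd: "?b d > 0" using b[of d] by simp
  \<comment> \<open>The product over \<open>f\<close> that the recursion forces for the root entry
    \<open>c\<close>. The entries \<open>w\<close> at \<open>u'\<close> and \<open>z\<close> at the
    inner vertices are then read off from their own equations.\<close>
  define p where "p = c ^ k * ?M / ?b d / (1 - \<alpha>)"
  have p: "p > 0" unfolding p_def using c ra bd \<alpha> by simp
  define w where "w = root k ((1 - \<alpha>) * p / ?b d)"
  define z where "z = root k ((1 - \<alpha>) * p / (\<rho> - \<alpha>))"
  have w: "w > 0" "w ^ k = (1 - \<alpha>) * p / ?b d"
    using p \<alpha> bd k by (simp_all add: w_def)
  have z: "z > 0" "z ^ k = (1 - \<alpha>) * p / (\<rho> - \<alpha>)"
    using p \<alpha> ra k by (simp_all add: z_def)
  obtain y0 where y0: "y0 u' = w" "\<And>v. v \<in> V \<Longrightarrow> 0 < y0 v"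
    "\<And>v. v \<in> V - {u'} \<Longrightarrow> vertex_form k \<alpha> E y0 v = \<rho> * y0 v ^ k"
    "vertex_form k \<alpha> E y0 u' = (\<rho> - \<alpha> - ?b d) * w ^ k"
    using rooted_path_Suc.IH[OF _ _ w(1)] b by (metis less_Suc_eq)
  define y where "y v = (if v \<in> V then y0 v else if v = u then c else z)" for v
  note ins = vertex_form_insert[OF F(3) fE, of k \<alpha> y]
  have yV: "vertex_form k \<alpha> E y v = vertex_form k \<alpha> E y0 v" if "v \<in> V" for v
    by (rule vertex_form_cong[of _ V]) (use that F(4) in \<open>auto simp: y_def\<close>)
  have mem: "u \<in> f" "u' \<in> f" "u' \<in> V" "u \<noteq> u'" using rooted_path_Suc.hyps(2-4) by auto
  have yu: "y u = c" "y u' = w" using mem e(6) y0(1) by (simp_all add: y_def)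
  have yR: "y v = z" if v: "v \<in> R" for v
  proof -
    have "v \<notin> V" "v \<noteq> u" using v e(2,7) by blast+
    then show ?thesis by (simp add: y_def)
  qed
  \<comment> \<open>Consistency: the entries computed from \<open>p\<close> really multiply to
    \<open>p\<close>. Both sides are nonnegative, so comparing \<open>k\<close>-th powers
    suffices.\<close>
  have pf: "prod y f = p"
  proof (rule power_eq_imp_eq_base)
    have "prod y f = c * w * z ^ (k - 2)"
      by (subst e(1)) (use e(2-5) yu yR in simp)
    then have "prod y f ^ k = c ^ k * w ^ k * (z ^ k) ^ (k - 2)"
      by (simp add: power_mult_distrib power_commutes flip: power_mult) (simp add: mult.commute)
    also have "\<dots> = c ^ k * ((1 - \<alpha>) * p / ?b d) * ((1 - \<alpha>) * p / (\<rho> - \<alpha>)) ^ (k - 2)"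
      by (simp only: w z)
    also have "\<dots> = p ^ k"
    proof -
      have "(1 - \<alpha>) * p = ?M / ?b d * c ^ k" unfolding p_def using \<alpha> by simp
      then show ?thesis using p \<alpha> k by (intro edge_product_iff[THEN iffD2, symmetric]) auto
    qed
    finally show "prod y f ^ k = p ^ k" .
    show "0 \<le> prod y f" using \<open>prod y f = c * w * z ^ (k - 2)\<close> c w z by simp
  qed (use p k in auto)
  show ?case
  proof (rule rooted_path_Suc.prems(1)[of y])
    show "y u = c" by (fact yu)
    show "0 < y v" if "v \<in> V \<union> f" for v using y0(2) c z by (auto simp: y_def)
    show "vertex_form k \<alpha> (insert f E) y v = \<rho> * y v ^ k" if v: "v \<in> V \<union> f - {u}" for v
    proof (cases "v \<in> V")
      case True
      show ?thesis
      proof (cases "v = u'")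
        case True
        have "?b d * w ^ k = (1 - \<alpha>) * p" using w(2) bd by simp
        then show ?thesis
          using True ins[of v] yV[of v] pf y0(4) yu mem by (simp add: algebra_simps)
      next
        case False
        then have "v \<notin> f" using \<open>v \<in> V\<close> rooted_path_Suc.hyps(2) by blast
        then show ?thesis
          using False \<open>v \<in> V\<close> ins[of v] yV[of v] y0(3)[of v] by (simp add: y_def)
      qed
    next
      case False
      then have v: "v \<in> R" "v \<in> f" using v mem by (auto simp: R_def)
      have "vertex_form k \<alpha> E y v = 0" using False F(4) by (intro vertex_form_notin) blast
      moreover have "(\<rho> - \<alpha>) * z ^ k = (1 - \<alpha>) * p" using z(2) ra by simp
      ultimately show ?thesis using ins[of v] v pf yR[of v] by (simp add: algebra_simps)
    qed
    have "vertex_form k \<alpha> E y u = 0" using F(4) e(6) by (intro vertex_form_notin) blast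
    then have "vertex_form k \<alpha> (insert f E) y u = \<alpha> * c ^ k + (1 - \<alpha>) * p"
      using ins[of u] mem pf yu by simp
    also have "(1 - \<alpha>) * p = ?M / ?b d * c ^ k" unfolding p_def using \<alpha> by simp
    finally show "vertex_form k \<alpha> (insert f E) y u = (\<rho> - \<alpha> - ?b (Suc d)) * c ^ k"
      by (simp add: path_coeff.simps(2) algebra_simps)
  qed
qed

section \<open>Attaching two paths\<close>

text \<open>Keeps only the vertex and edge sets of the two paths. It is interpreted twice, for
  lengths \<open>p\<close>, \<open>q\<close> and for lengths \<open>p + 1\<close>,
  \<open>q - 1\<close>, over the same \<open>G\<close>.\<close>

locale path_attachment =
  fixes k :: nat and G :: "'a hypergraph" and u v :: 'a and p q :: nat
    and EP :: "'a set set" and VP :: "'a set" and EQ :: "'a set set" and VQ :: "'a set"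
    and H :: "'a hypergraph"
  assumes k: "k \<ge> 3" and G: "uniform_hypergraph k G"
    and P: "rooted_path k u EP VP p" and Q: "rooted_path k v EQ VQ q"
    and VP_G: "VP \<inter> verts G = {u}" and VQ_G: "VQ \<inter> verts G = {v}" and VP_VQ: "VP \<inter> VQ = {}"
    and H: "H = \<lparr>verts = verts G \<union> VP \<union> VQ, edges = edges G \<union> EP \<union> EQ\<rparr>"

lemma attached_pathsE:
  assumes "attached_paths k G u v p q H" and k: "k \<ge> 3" and "uniform_hypergraph k G"
  obtains EP VP EQ VQ where "path_attachment k G u v p q EP VP EQ VQ H"
proof -
  obtain P Q vs es ws fs where *: "loose_path k P vs es" "length es = p" "hd vs = u"
    "loose_path k Q ws fs" "length fs = q" "hd ws = v"
    "verts P \<inter> verts G = {u}" "verts Q \<inter> verts G = {v}" "verts P \<inter> verts Q = {}"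
    "H = \<lparr>verts = verts G \<union> verts P \<union> verts Q, edges = edges G \<union> edges P \<union> edges Q\<rparr>"
    using assms(1) unfolding attached_paths_def by blast
  have "path_attachment k G u v p q (edges P) (verts P) (edges Q) (verts Q) H"
    using loose_path_imp_rooted_path[OF *(1)] loose_path_imp_rooted_path[OF *(4)] * assms
    by unfold_locales simp_all
  then show thesis by (rule that)
qed

context path_attachment
begin

lemma verts_H: "verts H = verts G \<union> VP \<union> VQ" and edges_H: "edges H = edges G \<union> EP \<union> EQ"
  by (simp_all add: H)

lemma roots_in_G: "u \<in> verts G" "v \<in> verts G" "u \<noteq> v"
  using VP_G VQ_G VP_VQ by blast+

lemma k_pos: "k \<ge> 1"
  using k by simp

text \<open>Any two of the three parts share at most one vertex, too few for a common edge. Hence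
  the vertex form of \<open>H\<close> is the sum of those of its parts.\<close>

lemma edges_disjoint: "edges G \<inter> EP = {}" "(edges G \<union> EP) \<inter> EQ = {}"
proof -
  note GE = uniform_hypergraphD[OF G k_pos] and PE = rooted_path_facts[OF P]
    and QE = rooted_path_facts[OF Q]
  have small: "\<not> e \<subseteq> {w}" if "card e = k" for e and w :: 'a
    using that card_mono[of "{w}" e] k by auto
  have "e \<notin> EP" if "e \<in> edges G" for e
    using GE(3,5)[OF that] PE(4)[of e] VP_G small[of e u] by blast
  then show "edges G \<inter> EP = {}" by blast
  have "e \<notin> EQ" if "e \<in> edges G" for e
    using GE(3,5)[OF that] QE(4)[of e] VQ_G small[of e v] by blast
  moreover have "e \<notin> EQ" if "e \<in> EP" for e
    using PE(4)[OF that] QE(4)[of e] VP_VQ small[of e v] by blast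
  ultimately show "(edges G \<union> EP) \<inter> EQ = {}" by blast
qed

lemma vertex_form_H:
  "vertex_form k \<alpha> (edges H) x w =
    vertex_form k \<alpha> (edges G) x w + vertex_form k \<alpha> EP x w + vertex_form k \<alpha> EQ x w"
  using uniform_hypergraphD(2)[OF G k_pos] rooted_path_facts(3)[OF P] rooted_path_facts(3)[OF Q]
    edges_disjoint
  by (simp add: edges_H vertex_form_union)

lemma vertex_form_outside:
  "w \<notin> verts G \<Longrightarrow> vertex_form k \<alpha> (edges G) x w = 0"
  "w \<notin> VP \<Longrightarrow> vertex_form k \<alpha> EP x w = 0"
  "w \<notin> VQ \<Longrightarrow> vertex_form k \<alpha> EQ x w = 0"
proof -
  show "w \<notin> verts G \<Longrightarrow> vertex_form k \<alpha> (edges G) x w = 0"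
    using uniform_hypergraphD(3)[OF G k_pos] by (intro vertex_form_notin) blast
  show "w \<notin> VP \<Longrightarrow> vertex_form k \<alpha> EP x w = 0"
    using rooted_path_facts(4)[OF P] by (intro vertex_form_notin) blast
  show "w \<notin> VQ \<Longrightarrow> vertex_form k \<alpha> EQ x w = 0"
    using rooted_path_facts(4)[OF Q] by (intro vertex_form_notin) blast
qed

lemma vertex_form_H_simps:
  "vertex_form k \<alpha> (edges H) x u = vertex_form k \<alpha> (edges G) x u + vertex_form k \<alpha> EP x u"
  "vertex_form k \<alpha> (edges H) x v = vertex_form k \<alpha> (edges G) x v + vertex_form k \<alpha> EQ x v"
  "w \<in> verts G - {u, v} \<Longrightarrow> vertex_form k \<alpha> (edges H) x w = vertex_form k \<alpha> (edges G) x w"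
  "w \<in> VP - {u} \<Longrightarrow> vertex_form k \<alpha> (edges H) x w = vertex_form k \<alpha> EP x w"
  "w \<in> VQ - {v} \<Longrightarrow> vertex_form k \<alpha> (edges H) x w = vertex_form k \<alpha> EQ x w"
proof -
  have "u \<notin> VQ" "v \<notin> VP" using VP_G VQ_G VP_VQ by blast+
  then show "vertex_form k \<alpha> (edges H) x u = vertex_form k \<alpha> (edges G) x u + vertex_form k \<alpha> EP x u"
    "vertex_form k \<alpha> (edges H) x v = vertex_form k \<alpha> (edges G) x v + vertex_form k \<alpha> EQ x v"
    by (simp_all add: vertex_form_H vertex_form_outside)
  show "vertex_form k \<alpha> (edges H) x w = vertex_form k \<alpha> (edges G) x w"
    if "w \<in> verts G - {u, v}"
  proof -
    have "w \<notin> VP" "w \<notin> VQ" using that VP_G VQ_G by blast+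
    then show ?thesis by (simp add: vertex_form_H vertex_form_outside)
  qed
  show "vertex_form k \<alpha> (edges H) x w = vertex_form k \<alpha> EP x w" if "w \<in> VP - {u}"
  proof -
    have "w \<notin> verts G" "w \<notin> VQ" using that VP_G VP_VQ by blast+
    then show ?thesis by (simp add: vertex_form_H vertex_form_outside)
  qed
  show "vertex_form k \<alpha> (edges H) x w = vertex_form k \<alpha> EQ x w" if "w \<in> VQ - {v}"
  proof -
    have "w \<notin> verts G" "w \<notin> VP" using that VQ_G VP_VQ by blast+
    then show ?thesis by (simp add: vertex_form_H vertex_form_outside)
  qed
qed

lemma uniform_H: "uniform_hypergraph k H"
proof -
  note GE = uniform_hypergraphD[OF G k_pos] and PE = rooted_path_facts[OF P]
    and QE = rooted_path_facts[OF Q]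
  show ?thesis
    unfolding uniform_hypergraph_def verts_H edges_H
    using GE(1,3,5) PE(2,4) QE(2,4) by blast
qed

lemma connected_H:
  assumes "connected_hypergraph G"
  shows "connected_hypergraph H"
proof -
  let ?R = "\<lambda>E. {(a, b). \<exists>e\<in>E. a \<in> e \<and> b \<in> e}"
  have mono: "(?R E)\<^sup>* \<subseteq> (?R (edges H))\<^sup>*" if "E \<subseteq> edges H" for E
    using that by (intro rtrancl_mono) blast
  have reach_G: "(u, w) \<in> (?R (edges H))\<^sup>*" if "w \<in> verts G" for w
    using assms roots_in_G(1) that mono[of "edges G"]
    unfolding connected_hypergraph_def edges_H by blast
  have reach: "(u, w) \<in> (?R (edges H))\<^sup>*" if w: "w \<in> verts H" for w
  proof -
    consider "w \<in> verts G" | "w \<in> VP" | "w \<in> VQ" using w verts_H by blast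
    then show ?thesis
    proof cases
      case 1
      then show ?thesis by (rule reach_G)
    next
      case 2
      then show ?thesis using rooted_path_connected[OF P] mono[of EP] edges_H by blast
    next
      case 3
      then have "(v, w) \<in> (?R (edges H))\<^sup>*"
        using rooted_path_connected[OF Q] mono[of EQ] edges_H by blast
      with reach_G[OF roots_in_G(2)] show ?thesis by (rule rtrancl_trans)
    qed
  qed
  have "sym ((?R (edges H))\<^sup>*)" by (intro sym_rtrancl) (auto simp: sym_def)
  then show ?thesis
    unfolding connected_hypergraph_def using reach roots_in_G(1)
    by (metis (no_types, lifting) UnCI empty_iff rtrancl_trans symD verts_H)
qed

text \<open>Subtracting the contribution of a path from the equation at its root leaves an equation
  inside \<open>G\<close> that depends on the path only through its length.\<close>

lemma eigenvector_restrict: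
  assumes \<alpha>: "0 \<le> \<alpha>" "\<alpha> < 1" and pos: "\<And>w. w \<in> verts H \<Longrightarrow> 0 < x w"
    and eq: "\<And>w. w \<in> verts H \<Longrightarrow> vertex_form k \<alpha> (edges H) x w = \<rho> * x w ^ k"
  shows "\<And>i. i < p \<Longrightarrow> 0 < path_coeff k \<alpha> \<rho> i"
    and "vertex_form k \<alpha> (edges G) x u = (\<alpha> + path_coeff k \<alpha> \<rho> p) * x u ^ k"
    and "vertex_form k \<alpha> (edges G) x v = (\<alpha> + path_coeff k \<alpha> \<rho> q) * x v ^ k"
proof -
  have "vertex_form k \<alpha> EP x w = \<rho> * x w ^ k" if "w \<in> VP - {u}" for w
    using eq[of w] that vertex_form_H_simps(4)[OF that, of \<alpha> x] by (simp add: verts_H)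
  moreover have "0 < x w" if "w \<in> VP" for w using pos that by (simp add: verts_H)
  ultimately have p: "(\<forall>i<p. 0 < path_coeff k \<alpha> \<rho> i)
      \<and> vertex_form k \<alpha> EP x u = (\<rho> - \<alpha> - path_coeff k \<alpha> \<rho> p) * x u ^ k"
    using rooted_path_eigenvector[OF P k \<alpha>] by blast
  have "vertex_form k \<alpha> EQ x w = \<rho> * x w ^ k" if "w \<in> VQ - {v}" for w
    using eq[of w] that vertex_form_H_simps(5)[OF that, of \<alpha> x] by (simp add: verts_H)
  moreover have "0 < x w" if "w \<in> VQ" for w using pos that by (simp add: verts_H)
  ultimately have q: "vertex_form k \<alpha> EQ x v = (\<rho> - \<alpha> - path_coeff k \<alpha> \<rho> q) * x v ^ k"
    using rooted_path_eigenvector[OF Q k \<alpha>] by blast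
  show "\<And>i. i < p \<Longrightarrow> 0 < path_coeff k \<alpha> \<rho> i" using p by blast
  show "vertex_form k \<alpha> (edges G) x u = (\<alpha> + path_coeff k \<alpha> \<rho> p) * x u ^ k"
    using eq[of u] p roots_in_G by (simp add: vertex_form_H_simps verts_H algebra_simps)
  show "vertex_form k \<alpha> (edges G) x v = (\<alpha> + path_coeff k \<alpha> \<rho> q) * x v ^ k"
    using eq[of v] q roots_in_G by (simp add: vertex_form_H_simps verts_H algebra_simps)
qed

text \<open>Glues any positive vector on \<open>G\<close> to exact solutions on both paths. The new
  vertices then contribute no defect, and comparing Rayleigh quotients reduces to vertices of
  \<open>G\<close>.\<close>

lemma extend_along_paths:
  assumes \<alpha>: "0 \<le> \<alpha>" "\<alpha> < 1" and pos: "\<And>w. w \<in> verts G \<Longrightarrow> 0 < z w"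
    and b: "\<And>i. i < max p q \<Longrightarrow> 0 < path_coeff k \<alpha> \<rho> i"
  obtains y where "\<And>w. w \<in> verts G \<Longrightarrow> y w = z w" and "\<And>w. w \<in> verts H \<Longrightarrow> 0 < y w"
    and "\<And>w. w \<in> verts H - verts G \<Longrightarrow> vertex_form k \<alpha> (edges H) y w = \<rho> * y w ^ k"
    and "vertex_form k \<alpha> (edges H) y u =
      vertex_form k \<alpha> (edges G) z u + (\<rho> - \<alpha> - path_coeff k \<alpha> \<rho> p) * z u ^ k"
    and "vertex_form k \<alpha> (edges H) y v =
      vertex_form k \<alpha> (edges G) z v + (\<rho> - \<alpha> - path_coeff k \<alpha> \<rho> q) * z v ^ k"
    and "\<And>w. w \<in> verts G - {u, v} \<Longrightarrow>
      vertex_form k \<alpha> (edges H) y w = vertex_form k \<alpha> (edges G) z w"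
proof -
  obtain yP where yP: "yP u = z u" "\<And>w. w \<in> VP \<Longrightarrow> 0 < yP w"
    "\<And>w. w \<in> VP - {u} \<Longrightarrow> vertex_form k \<alpha> EP yP w = \<rho> * yP w ^ k"
    "vertex_form k \<alpha> EP yP u = (\<rho> - \<alpha> - path_coeff k \<alpha> \<rho> p) * z u ^ k"
    using rooted_path_extend[OF P k \<alpha>, of \<rho> "z u" thesis] b pos roots_in_G by auto
  obtain yQ where yQ: "yQ v = z v" "\<And>w. w \<in> VQ \<Longrightarrow> 0 < yQ w"
    "\<And>w. w \<in> VQ - {v} \<Longrightarrow> vertex_form k \<alpha> EQ yQ w = \<rho> * yQ w ^ k"
    "vertex_form k \<alpha> EQ yQ v = (\<rho> - \<alpha> - path_coeff k \<alpha> \<rho> q) * z v ^ k"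
    using rooted_path_extend[OF Q k \<alpha>, of \<rho> "z v" thesis] b pos roots_in_G by auto
  define y where "y w = (if w \<in> verts G then z w else if w \<in> VP then yP w else yQ w)" for w
  have yG: "y w = z w" if "w \<in> verts G" for w using that by (simp add: y_def)
  have y_VP: "y w = yP w" if "w \<in> VP" for w
  proof (cases "w = u")
    case False
    then have "w \<notin> verts G" using that VP_G by blast
    then show ?thesis using that by (simp add: y_def)
  qed (use roots_in_G yP(1) in \<open>simp add: y_def\<close>)
  have y_VQ: "y w = yQ w" if "w \<in> VQ" for w
  proof (cases "w = v")
    case False
    then have "w \<notin> verts G" "w \<notin> VP" using that VQ_G VP_VQ by blast+
    then show ?thesis by (simp add: y_def)
  qed (use roots_in_G yQ(1) in \<open>simp add: y_def\<close>)
  have formG: "vertex_form k \<alpha> (edges G) y w = vertex_form k \<alpha> (edges G) z w" if "w \<in> verts G" for w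
    using that yG uniform_hypergraphD(3)[OF G k_pos] by (rule vertex_form_cong)
  have formP: "vertex_form k \<alpha> EP y w = vertex_form k \<alpha> EP yP w" if "w \<in> VP" for w
    by (rule vertex_form_cong[OF that y_VP]) (use rooted_path_facts(4)[OF P] in blast)+
  have formQ: "vertex_form k \<alpha> EQ y w = vertex_form k \<alpha> EQ yQ w" if "w \<in> VQ" for w
    by (rule vertex_form_cong[OF that y_VQ]) (use rooted_path_facts(4)[OF Q] in blast)+
  note uV = rooted_path_facts(1)[OF P] and vV = rooted_path_facts(1)[OF Q]
  show thesis
  proof (rule that[of y, OF yG])
    show "0 < y w" if "w \<in> verts H" for w
      using that yG y_VP y_VQ pos yP(2) yQ(2) unfolding verts_H by (metis UnE)
    show "vertex_form k \<alpha> (edges H) y w = \<rho> * y w ^ k" if w: "w \<in> verts H - verts G" for w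
    proof -
      consider "w \<in> VP - {u}" | "w \<in> VQ - {v}" using w roots_in_G unfolding verts_H by blast
      then show ?thesis
      proof cases
        case 1
        then show ?thesis using formP[of w] yP(3)[of w] y_VP[of w] by (simp add: vertex_form_H_simps)
      next
        case 2
        then show ?thesis using formQ[of w] yQ(3)[of w] y_VQ[of w] by (simp add: vertex_form_H_simps)
      qed
    qed
  qed (simp_all add: vertex_form_H_simps formG formP formQ roots_in_G uV vV yP(4) yQ(4))
qed

end

section \<open>Comparing the two attachments\<close>

lemma vertex_form_pendant:
  assumes "vertex_degree G w = 1" and "e \<in> edges G" and "w \<in> e"
  shows "f \<in> edges G \<Longrightarrow> w \<in> f \<Longrightarrow> f = e"
    and "vertex_form k \<alpha> (edges G) x w = \<alpha> * x w ^ k + (1 - \<alpha>) * prod x e"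
proof -
  obtain e' where e': "{f \<in> edges G. w \<in> f} = {e'}"
    using assms(1) unfolding vertex_degree_def by (rule card_1_singletonE)
  have "e \<in> {f \<in> edges G. w \<in> f}" using assms(2,3) by simp
  then have *: "{f \<in> edges G. w \<in> f} = {e}" unfolding e' by simp
  show "f = e" if "f \<in> edges G" "w \<in> f"
  proof -
    have "f \<in> {f \<in> edges G. w \<in> f}" using that by simp
    then show ?thesis unfolding * by simp
  qed
  show "vertex_form k \<alpha> (edges G) x w = \<alpha> * x w ^ k + (1 - \<alpha>) * prod x e"
    unfolding vertex_form_def * by simp
qed

text \<open>Multiplying the relations at all vertices of \<open>e\<close> gives
  \<open>(a * prod x e) ^ k\<close> on one side and
  \<open>b * c * r ^ (k - 2) * prod x e ^ k\<close> on the other; the strict relation at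
  \<open>w\<close> makes the product inequality strict.\<close>

lemma edge_coeff_product:
  fixes x :: "'a \<Rightarrow> real" and a b c r :: real
  assumes "finite e" and "card e = k" and "u \<in> e" and "v \<in> e" and "u \<noteq> v" and "w \<in> e - {u, v}"
    and pos: "\<And>z. z \<in> e \<Longrightarrow> 0 < x z" and a: "a > 0" and r: "r > 0"
    and u: "b * x u ^ k = a * prod x e" and v: "c * x v ^ k = a * prod x e"
    and le: "\<And>z. z \<in> e - {u, v} \<Longrightarrow> a * prod x e \<le> r * x z ^ k"
    and less: "a * prod x e < r * x w ^ k"
  shows "a ^ k / r ^ (k - 2) < b * c"
proof -
  let ?p = "prod x e"
  define R where "R = e - {u, v}"
  have R: "finite R" "card R = k - 2" "w \<in> R" "e = insert u (insert v R)" "u \<notin> insert v R" "v \<notin> R"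
    using assms(1-6) by (auto simp: R_def card_Diff_subset)
  have p: "?p > 0" using pos by (intro prod_pos) auto
  have pk: "?p ^ k = x u ^ k * (x v ^ k * (\<Prod>z\<in>R. x z ^ k))"
    unfolding prod_power_distrib[symmetric] by (subst R(4)) (use R in \<open>simp add: power_mult_distrib\<close>)
  have "(a * ?p) ^ (k - 2) = (\<Prod>z\<in>R. a * ?p)" by (simp add: R)
  also have "\<dots> < (\<Prod>z\<in>R. r * x z ^ k)"
    using R(1,3) less le a r p pos by (intro prod_mono_strict[of w]) (auto simp: R_def)
  also have "\<dots> = r ^ (k - 2) * (\<Prod>z\<in>R. x z ^ k)" by (simp add: prod.distrib R)
  finally have "(a * ?p) * (a * ?p) * (a * ?p) ^ (k - 2)
      < (a * ?p) * (a * ?p) * (r ^ (k - 2) * (\<Prod>z\<in>R. x z ^ k))"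
    using a p by simp
  also have "\<dots> = (b * x u ^ k) * (c * x v ^ k) * (r ^ (k - 2) * (\<Prod>z\<in>R. x z ^ k))"
    by (simp only: u v)
  also have "\<dots> = b * c * r ^ (k - 2) * ?p ^ k" unfolding pk by (simp add: mult_ac)
  also have "(a * ?p) * (a * ?p) * (a * ?p) ^ (k - 2) = (a * ?p) ^ k"
  proof -
    have "card {u, v} \<le> card e" using assms(1,3,4) by (intro card_mono) auto
    then have "k = Suc (Suc (k - 2))" using assms(2,5) by simp
    then show ?thesis by (metis mult.assoc power_Suc)
  qed
  finally have "a ^ k < b * c * r ^ (k - 2)" using p by (simp add: power_mult_distrib)
  then show ?thesis using r by (simp add: divide_less_eq)
qed

text \<open>The difference of the two sides factors as \<open>(c - b) / c\<close> times the excess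
  of the right-hand product over \<open>M\<close>; the first factor is positive because the
  coefficients decrease.\<close>

lemma path_coeff_exchange:
  assumes \<alpha>: "0 \<le> \<alpha>" "\<alpha> < 1" and pq: "q < p"
    and pos: "\<And>i. i \<le> p \<Longrightarrow> 0 < path_coeff k \<alpha> \<rho> i"
    and M: "(1 - \<alpha>) ^ k / (\<rho> - \<alpha>) ^ (k - 2) < path_coeff k \<alpha> \<rho> (Suc p) * path_coeff k \<alpha> \<rho> q"
  shows "path_coeff k \<alpha> \<rho> p * path_coeff k \<alpha> \<rho> (Suc q)
    < path_coeff k \<alpha> \<rho> (Suc p) * path_coeff k \<alpha> \<rho> q"
proof -
  define b where "b = path_coeff k \<alpha> \<rho> p"
  define c where "c = path_coeff k \<alpha> \<rho> q"
  define M where "M = (1 - \<alpha>) ^ k / (\<rho> - \<alpha>) ^ (k - 2)"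
  define B where "B = \<rho> - 2 * \<alpha>"
  have "b < c"
    unfolding b_def c_def by (rule path_coeff_strict_decreasing[of p]) (use pos \<alpha> pq in auto)
  have bc: "0 < b" "0 < c" using pos pq by (auto simp: b_def c_def)
  have S: "path_coeff k \<alpha> \<rho> (Suc p) = B - M / b" "path_coeff k \<alpha> \<rho> (Suc q) = B - M / c"
    by (simp_all add: B_def M_def b_def c_def path_coeff.simps(2))
  have "0 < (c - b) / c * ((B - M / b) * c - M)"
    using M \<open>b < c\<close> bc unfolding S(1) by (simp add: M_def c_def)
  also have "\<dots> = (B - M / b) * c - b * (B - M / c)"
    using bc by (simp add: field_simps)
  finally show ?thesis unfolding S by (simp add: b_def c_def)
qed

theorem theorem4p3:
  fixes G H H' :: "'a hypergraph" and \<alpha> :: real and k p q :: nat and u v :: 'a and e :: "'a set"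
  assumes "k \<ge> 3" and "0 \<le> \<alpha>" and "\<alpha> < 1"
    and "uniform_hypergraph k G" and "connected_hypergraph G"
    and "pendant_edge G e" and "u \<in> e" and "v \<in> e" and "u \<noteq> v"
    and "edges G \<noteq> {e}"
    and "pendant_vertex G u" and "pendant_vertex G v"
    and "p \<ge> q" and "q \<ge> 1"
    and "attached_paths k G u v p q H"
    and "attached_paths k G u v (p + 1) (q - 1) H'"
  shows "alpha_spectral_radius k \<alpha> H > alpha_spectral_radius k \<alpha> H'"
proof -
  note k = assms(1) and \<alpha> = assms(2,3) and G = assms(4) and uv = assms(7-9)
  obtain EP VP EQ VQ where "path_attachment k G u v p q EP VP EQ VQ H"
    using attached_pathsE[OF assms(15) k G] .
  then interpret A: path_attachment k G u v p q EP VP EQ VQ H .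
  obtain EP' VP' EQ' VQ' where "path_attachment k G u v (p + 1) (q - 1) EP' VP' EQ' VQ' H'"
    using attached_pathsE[OF assms(16) k G] .
  then interpret A': path_attachment k G u v "p + 1" "q - 1" EP' VP' EQ' VQ' H' .
  note GE = uniform_hypergraphD[OF G A.k_pos]
  have e: "e \<in> edges G" using assms(6) by (simp add: pendant_edge_def)
  have deg: "vertex_degree G u = 1" "vertex_degree G v = 1"
    using assms(11,12) by (simp_all add: pendant_vertex_def)
  note only_u = vertex_form_pendant[OF deg(1) e uv(1)]
    and only_v = vertex_form_pendant[OF deg(2) e uv(2)]
  define \<rho> where "\<rho> = alpha_spectral_radius k \<alpha> H'"
  let ?b = "path_coeff k \<alpha> \<rho>"
  obtain x where pos: "\<And>w. w \<in> verts H' \<Longrightarrow> 0 < x w"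
    and eq: "\<And>w. w \<in> verts H' \<Longrightarrow> vertex_form k \<alpha> (edges H') x w = \<rho> * x w ^ k"
    using perron_vector[OF A'.uniform_H A.k_pos A'.connected_H[OF assms(5)] \<alpha>]
    unfolding \<rho>_def by metis
  have posG: "0 < x w" if "w \<in> verts G" for w using pos that by (simp add: A'.verts_H)
  have eqG: "vertex_form k \<alpha> (edges G) x w = \<rho> * x w ^ k" if "w \<in> verts G - {u, v}" for w
    using A'.vertex_form_H_simps(3)[OF that, of \<alpha> x] eq[of w] that by (simp add: A'.verts_H)
  note R = A'.eigenvector_restrict[OF \<alpha> pos eq]
  \<comment> \<open>The path at \<open>u\<close> in \<open>H'\<close> has \<open>p + 1\<close>
    edges, so positivity reaches index \<open>p\<close>. For \<open>?b (Suc p)\<close> it is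
    obtained separately, from the equation at \<open>u\<close>.\<close>
  have b_pos: "0 < ?b i" if "i \<le> p" for i using R(1)[of i] that by simp
  have ra: "\<rho> - \<alpha> > 0" using b_pos[of 0] by simp
  have ep: "0 < prod x e" using posG GE(3)[OF e] by (intro prod_pos) auto
  have bu: "?b (Suc p) * x u ^ k = (1 - \<alpha>) * prod x e"
    using R(2) only_u(2)[of k \<alpha> x] by (simp add: algebra_simps)
  have bv: "?b (q - 1) * x v ^ k = (1 - \<alpha>) * prod x e"
    using R(3) only_v(2)[of k \<alpha> x] by (simp add: algebra_simps)
  have "0 < ?b (Suc p) * x u ^ k" unfolding bu using ep \<alpha> by simp
  then have bSp: "0 < ?b (Suc p)"
    using posG[OF A.roots_in_G(1)] by (simp add: zero_less_mult_iff)

  \<comment> \<open>Connectivity and \<open>edges G \<noteq> {e}\<close> provide a vertex of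
    \<open>e\<close> on a further edge. The product over \<open>f\<close> is the source of
    strictness.\<close>
  obtain f w where f: "f \<in> edges G" "f \<noteq> e" "w \<in> f" "w \<in> e"
  proof -
    have "e \<noteq> {}" using uv by blast
    show thesis
    proof (cases "e = verts G")
      case True
      obtain f where f: "f \<in> edges G" "f \<noteq> e" using e assms(10) by blast
      have "f \<noteq> {}" using GE(5)[OF f(1)] k by auto
      then show thesis using that f GE(3)[OF f(1)] True by blast
    next
      case False
      then obtain f a b where "f \<in> edges G" "a \<in> f" "b \<in> f" "a \<in> e" "b \<notin> e"
        using connected_hypergraph_crossing_edge[OF assms(5) GE(3)[OF e] \<open>e \<noteq> {}\<close>] by metis
      then show thesis using that by blast
    qed
  qed
  have w_uv: "w \<in> e - {u, v}" using f only_u(1) only_v(1) by blast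
  \<comment> \<open>Discards nonnegative terms of the equation at \<open>z\<close>. Keeping only
    \<open>e\<close> gives the weak relation, keeping \<open>e\<close> and \<open>f\<close> the
    strict one at \<open>w\<close>.\<close>
  have sum_le: "(\<Sum>f\<in>F. \<alpha> * x z ^ k + (1 - \<alpha>) * prod x f) \<le> \<rho> * x z ^ k"
    if z: "z \<in> e - {u, v}" and F: "F \<subseteq> {f \<in> edges G. z \<in> f}" for z F
  proof -
    have "z \<in> verts G - {u, v}" using z GE(3)[OF e] by blast
    then have "\<rho> * x z ^ k = (\<Sum>f | f \<in> edges G \<and> z \<in> f. \<alpha> * x z ^ k + (1 - \<alpha>) * prod x f)"
      using eqG[of z] unfolding vertex_form_def by simp
    moreover have "0 \<le> \<alpha> * x z ^ k + (1 - \<alpha>) * prod x f" if "f \<in> edges G" for f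
    proof (intro add_nonneg_nonneg mult_nonneg_nonneg prod_nonneg zero_le_power)
      show "0 \<le> x z" using z GE(3)[OF e] posG[of z] by (auto intro: less_imp_le)
      show "0 \<le> x w" if "w \<in> f" for w
        using that GE(3)[OF \<open>f \<in> edges G\<close>] posG[of w] by (auto intro: less_imp_le)
    qed (use \<alpha> in auto)
    moreover have "finite {f \<in> edges G. z \<in> f}" using GE(2) by simp
    ultimately show ?thesis
      using F by (auto intro!: sum_mono2)
  qed
  have le: "(1 - \<alpha>) * prod x e \<le> (\<rho> - \<alpha>) * x z ^ k" if z: "z \<in> e - {u, v}" for z
    using sum_le[OF z, of "{e}"] z e by (simp add: algebra_simps)
  have less: "(1 - \<alpha>) * prod x e < (\<rho> - \<alpha>) * x w ^ k"
  proof -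
    have "0 < (1 - \<alpha>) * prod x f"
      using \<alpha> posG GE(3)[OF f(1)] by (intro mult_pos_pos prod_pos) auto
    moreover have "0 \<le> \<alpha> * x w ^ k"
    proof -
      have "0 < x w" using posG GE(3)[OF e] f(4) by blast
      then show ?thesis using \<alpha> by simp
    qed
    ultimately show ?thesis
      using sum_le[OF w_uv, of "{e, f}"] f e by (auto simp: algebra_simps)
  qed
  have "(1 - \<alpha>) ^ k / (\<rho> - \<alpha>) ^ (k - 2) < ?b (Suc p) * ?b (q - 1)"
    by (rule edge_coeff_product[OF GE(4,5)[OF e] uv w_uv _ _ ra bu bv le less])
      (use posG GE(3)[OF e] \<alpha> in auto)
  \<comment> \<open>The exchange is applied to the indices \<open>q - 1 < p\<close>.\<close>
  then have exch: "?b p * ?b (Suc (q - 1)) < ?b (Suc p) * ?b (q - 1)"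
    by (intro path_coeff_exchange[OF \<alpha>]) (use assms(13,14) b_pos in auto)
  have q: "Suc (q - 1) = q" using assms(14) by simp
  have b0: "0 < ?b p" "0 < ?b q" "0 < ?b (q - 1)" using b_pos assms(13) by auto
  \<comment> \<open>The scalings are chosen so that \<open>?b p * z u ^ k\<close> and
    \<open>?b q * z v ^ k\<close> both equal the old value \<open>(1 - \<alpha>) * prod x e\<close>;
    \<open>exch\<close> says that \<open>r * s\<close> exceeds 1.\<close>
  define r where "r = root k (?b (Suc p) / ?b p)"
  define s where "s = root k (?b (q - 1) / ?b q)"
  have rk: "0 < r" "r ^ k = ?b (Suc p) / ?b p"
    using b0 bSp k by (simp_all add: r_def)
  have sk: "0 < s" "s ^ k = ?b (q - 1) / ?b q" using b0 k by (simp_all add: s_def)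
  have "1 < (r * s) ^ k"
    using exch b0 unfolding power_mult_distrib rk sk q
    by (simp add: less_divide_eq mult_ac)
  then have rs: "1 < r * s"
    using rk sk by (metis linorder_not_le mult_nonneg_nonneg less_imp_le power_le_one)
  define z where "z w = (if w = u then r * x w else if w = v then s * x w else x w)" for w
  have z_pos: "0 < z w" if "w \<in> verts G" for w using posG[OF that] rk(1) sk(1) by (auto simp: z_def)
  have prod_z: "prod x e < prod z e"
  proof -
    define D where "D = e - {u, v}"
    have D: "e = insert u (insert v D)" "u \<notin> insert v D" "v \<notin> D" "finite D"
      using uv GE(4)[OF e] by (auto simp: D_def)
    have "prod z D = prod x D" using D by (intro prod.cong) (auto simp: z_def)
    then have "prod z e = r * s * prod x e"
      unfolding D(1) using D uv(3) by (simp add: z_def mult_ac)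
    then show ?thesis using rs ep by simp
  qed
  have prod_same: "prod z f = prod x f" if "f \<in> edges G" "f \<noteq> e" for f
  proof -
    have "u \<notin> f" "v \<notin> f" using only_u(1) only_v(1) that by blast+
    then show ?thesis by (intro prod.cong) (auto simp: z_def)
  qed
  have b_max: "0 < ?b i" if "i < max p q" for i using that b_pos assms(13) by simp
  obtain y where y: "\<And>w. w \<in> verts G \<Longrightarrow> y w = z w" "\<And>w. w \<in> verts H \<Longrightarrow> 0 < y w"
    "\<And>w. w \<in> verts H - verts G \<Longrightarrow> vertex_form k \<alpha> (edges H) y w = \<rho> * y w ^ k"
    "vertex_form k \<alpha> (edges H) y u = vertex_form k \<alpha> (edges G) z u + (\<rho> - \<alpha> - ?b p) * z u ^ k"
    "vertex_form k \<alpha> (edges H) y v = vertex_form k \<alpha> (edges G) z v + (\<rho> - \<alpha> - ?b q) * z v ^ k"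
    "\<And>w. w \<in> verts G - {u, v} \<Longrightarrow>
      vertex_form k \<alpha> (edges H) y w = vertex_form k \<alpha> (edges G) z w"
    using A.extend_along_paths[where z = z, OF \<alpha> z_pos b_max] by metis
  have gain: "(1 - \<alpha>) * prod x e < (1 - \<alpha>) * prod z e" using prod_z \<alpha> by simp
  \<comment> \<open>With the old product over \<open>e\<close> this would be an equality, so the
    defect is exactly the gain in that product.\<close>
  have at_u: "\<rho> * y u ^ k < vertex_form k \<alpha> (edges H) y u"
  proof -
    have "?b p * z u ^ k = (1 - \<alpha>) * prod x e"
      using rk b0 bu by (simp add: z_def power_mult_distrib)
    then show ?thesis
      using y(1,4) only_u(2)[of k \<alpha> z] A.roots_in_G gain by (simp add: algebra_simps)
  qed
  have at_v: "\<rho> * y v ^ k < vertex_form k \<alpha> (edges H) y v"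
  proof -
    have "?b q * z v ^ k = (1 - \<alpha>) * prod x e"
      using sk b0 bv uv(3) by (simp add: z_def power_mult_distrib)
    then show ?thesis
      using y(1,5) only_v(2)[of k \<alpha> z] A.roots_in_G gain by (simp add: algebra_simps)
  qed
  have at_G: "\<rho> * y w ^ k \<le> vertex_form k \<alpha> (edges H) y w" if w: "w \<in> verts G - {u, v}" for w
  proof -
    have zw: "z w = x w" "y w = x w" using w y(1) by (auto simp: z_def)
    have "vertex_form k \<alpha> (edges G) x w \<le> vertex_form k \<alpha> (edges G) z w"
      unfolding vertex_form_def zw
    proof (intro sum_mono add_left_mono mult_left_mono)
      fix f assume "f \<in> {f \<in> edges G. w \<in> f}"
      then show "prod x f \<le> prod z f" using prod_same[of f] prod_z by (cases "f = e") auto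
    qed (use \<alpha> in simp)
    then show ?thesis using eqG[OF w] y(6)[OF w] zw by simp
  qed
  \<comment> \<open>Equality on the new vertices, a weak inequality on the rest of \<open>G\<close>
    and strictness at \<open>u\<close> make \<open>y\<close> a test vector with Rayleigh quotient
    above \<rho>.\<close>
  have "\<rho> * (\<Sum>w\<in>verts H. y w ^ k) < (\<Sum>w\<in>verts H. vertex_form k \<alpha> (edges H) y w)"
    unfolding sum_distrib_left
  proof (rule sum_strict_mono_ex1)
    show "finite (verts H)" using uniform_hypergraphD(1)[OF A.uniform_H A.k_pos] .
    show "\<forall>w\<in>verts H. \<rho> * y w ^ k \<le> vertex_form k \<alpha> (edges H) y w"
      using at_u at_v at_G y(3) by (metis DiffI insertE less_imp_le order_refl singletonD)
    show "\<exists>w\<in>verts H. \<rho> * y w ^ k < vertex_form k \<alpha> (edges H) y w"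
      using at_u A.roots_in_G by (auto simp: A.verts_H)
  qed
  also have "\<dots> \<le> alpha_spectral_radius k \<alpha> H * (\<Sum>w\<in>verts H. y w ^ k)"
    using perron_vector[OF A.uniform_H A.k_pos A.connected_H[OF assms(5)] \<alpha>] y(2)
    by (metis less_imp_le)
  finally have "\<rho> * (\<Sum>w\<in>verts H. y w ^ k)
      < alpha_spectral_radius k \<alpha> H * (\<Sum>w\<in>verts H. y w ^ k)" .
  moreover have "0 \<le> (\<Sum>w\<in>verts H. y w ^ k)"
    using y(2) by (intro sum_nonneg) (simp add: less_imp_le)
  ultimately show ?thesis
    unfolding \<rho>_def by (metis linorder_not_le mult_right_mono)
qed

end
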